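(* Let $R\in\mathfrak P$ and let $f$ be a meromorphic function on $\mathfrak a_{\mathbb C}$ such that, for all $x\in\mathfrak M_{sing}$, there is an open ball $B_x$ around $x$ such that $f$ is holomorphic on $B_x\setminus\bigcup_{g\in\mathfrak A_x}\{u: g(u-x)=0\}$. Then $$\mathrm{JK}(f,\zeta)=\sum_{x\in\mathfrak M_{sing}}\tilde\epsilon(x)\,\mathrm{IR}_0(\phi_x(f)),$$ where $\tilde\epsilon(x)=1$ if the components of $\tilde\theta$ with respect to the basis $\mathfrak A_x$ of $V$ are all negative, and $\tilde\epsilon(x)=0$ otherwise.
   Context: **Setting.** $Q$ is a finite quiver without loops or oriented cycles, with the full abelian dimension vector $\mathbb I=\sum_{v\in Q_0}v$, and $\theta\in\mathbb{R}Q_0$ satisfies $\sum_v\theta_v=0$. Fix $v_0\in Q_0$; $\mathfrak a=\mathbb{R}^{Q_0\setminus\{v_0\}}$ with coordinates $u_v$, $u_{v_0}:=0$; $V=\mathfrak a^*$, $n=|Q_0|-1$. $\mathcal W\subset V$ is the set of weights $\rho=u_{h(\alpha)}-u_{t(\alpha)}$, $\alpha\in Q_1$ (head and tail of $\alpha$). $\tilde\theta=\sum_{v\ne v_0}\theta_vu_v\in V$. For finite $S\subset V$, a vector of $V$ is $S$-regular if it lies in no subspace spanned by $n-1$ elements of $S$; the connected components of the set of $S$-regular vectors are the $S$-chambers; $\Sigma S$ is the set of all sums of distinct elements of $S$. Assume $\tilde\theta$ is $\mathcal W$-regular, and let $\zeta\in V$ be a $\Sigma\mathcal W$-regular vector in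 the same $\mathcal W$-chamber as $-\tilde\theta$. **$R$-charges and singular points.** For $R\in\mathbb{R}^{\mathcal W}$ let $H_\rho=\{\rho+R_\rho=0\}\subset\mathfrak a_{\mathbb C}$. $\mathfrak M_{sing}\subset\mathfrak a_{\mathbb C}$ is the set of points where at least $|Q_0|-1$ linearly independent hyperplanes $H_\rho$ meet; $\mathfrak A_x=\{\rho\in\mathcal W:x\in H_\rho\}$. $\mathfrak P\subset\mathbb{R}^{\mathcal W}$ is a dense open cone such that for $R\in\mathfrak P$ no $|Q_0|$ of the hyperplanes $H_\rho$ contain a common point of $\mathfrak M_{sing}$; hence $\mathfrak A_x$ is a basis of $V$ for each $x\in\mathfrak M_{sing}$. **Iterated residue.** For a germ $f$ at $0\in\mathbb{C}^n$ of meromorphic function, $\mathrm{Res}_{z_1=0}f$ is the coefficient of $z_1^{-1}$ in the Laurent expansion of $f$ in $z_1$ with coefficients germs of meromorphic functions of $z_2,\dots,z_n$; $\mathrm{IR}_0(f)=\mathrm{Res}_{z_n=0}\cdots\mathrm{Res}_{z_1=0}f$. **JK residue.** For $A\subset V$ finite, spanning, contained in an open half-space, fix $d\mu=f_1\wedge\dots\wedge f_n$ with $f_i\in A$ a basis of $V$. $\mathcal{FL}(A)$ is the set of complete flags $\mathfrak F=[0=F_0\subset\dots\subset F_n=V]$, $\dim F_j=j$, with each $F_j$ spanned by elements of $A$; $\kappa_j^{\mathfrak F}=\sum_{\alpha\in A\cap F_j}\alpha$; $\nu(\mathfrak F)=0,1,-1$ if $(\kappa_j^{\mathfrak F})_j$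 is not a basis, a positively, a negatively oriented basis for $d\mu$; $\mathrm{Res}_{\mathfrak F}(f)=\mathrm{IR}_0$ of $f$ written in coordinates $z_i=\gamma_i$, with $\gamma$ a basis of $V$ such that $\gamma_1,\dots,\gamma_m$ span $F_m$ for all $m$ and $\gamma_1\wedge\dots\wedge\gamma_n=d\mu$. For $\zeta$ $\Sigma A$-regular, $\mathrm{JK}_\zeta^A(f)=\sum_{\mathfrak F:\ \zeta\in\sum_j\mathbb{R}_{>0}\kappa_j^{\mathfrak F}}\nu(\mathfrak F)\mathrm{Res}_{\mathfrak F}(f)$. For $f$ meromorphic on $\mathfrak a_{\mathbb C}$, $\mathrm{JK}(f,\zeta)=\sum_{x\in\mathfrak M_{sing}}\mathrm{JK}_\zeta^{\mathfrak A_x}(f(\cdot+x))$. **The map $\phi_x$.** $\phi_x$ is the isomorphism from germs of meromorphic functions at $x\in\mathfrak a_{\mathbb C}$ to germs of meromorphic functions at $0\in\mathbb{C}^{|Q_0|-1}$ given by translating $x$ to $0$ and using the elements of $\mathfrak A_x$, in an arbitrary chosen ordering, as coordinates. *)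

theory Defs
  imports
    "HOL-Complex_Analysis.Complex_Analysis"
    "HOL-Combinatorics.Permutations"
    "Graph_Theory.Arc_Walk"
begin

text \<open>
  The vertex set of the quiver is the finite type \<open>'v\<close>, so that \<open>n = CARD('v) - 1\<close>.
  The space of functions on the vertices other than \<open>v0\<close> is realised inside the space of
  functions on all vertices by the convention that the coordinate at \<open>v0\<close> is zero.
  An element \<open>\<xi>\<close> of the dual space stands for the functional \<open>\<Sum>v. \<xi> $ v * u\<^sub>v\<close>.
\<close>

definition real_a :: "'v::finite \<Rightarrow> (real ^ 'v) set" where
  "real_a v0 = {u. u $ v0 = 0}"

definition complex_a :: "'v::finite \<Rightarrow> (complex ^ 'v) set" where
  "complex_a v0 = {u. u $ v0 = 0}"

definition dual_a :: "'v::finite \<Rightarrow> (real ^ 'v) set" where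
  "dual_a v0 = {\<xi>. \<xi> $ v0 = 0}"

definition coord :: "'v::finite \<Rightarrow> 'v \<Rightarrow> real ^ 'v" where
  "coord v0 v = (if v = v0 then 0 else axis v 1)"

definition pair_real :: "real ^ 'v::finite \<Rightarrow> real ^ 'v \<Rightarrow> real" where
  "pair_real \<xi> u = (\<Sum>v\<in>UNIV. \<xi> $ v * u $ v)"

definition pair_complex :: "real ^ 'v::finite \<Rightarrow> complex ^ 'v \<Rightarrow> complex" where
  "pair_complex \<xi> u = (\<Sum>v\<in>UNIV. of_real (\<xi> $ v) * u $ v)"

definition is_basis :: "'v::finite \<Rightarrow> (real ^ 'v) set \<Rightarrow> bool" where
  "is_basis v0 B \<longleftrightarrow> independent B \<and> span B = dual_a v0"

definition is_basis_list :: "'v::finite \<Rightarrow> (real ^ 'v) list \<Rightarrow> bool" where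
  "is_basis_list v0 bs \<longleftrightarrow> distinct bs \<and> is_basis v0 (set bs)"

definition weights :: "('v::finite, 'e) pre_digraph \<Rightarrow> 'v \<Rightarrow> (real ^ 'v) set" where
  "weights Q v0 = (\<lambda>\<alpha>. coord v0 (head Q \<alpha>) - coord v0 (tail Q \<alpha>)) ` arcs Q"

definition theta_tilde :: "'v::finite \<Rightarrow> real ^ 'v \<Rightarrow> real ^ 'v" where
  "theta_tilde v0 \<theta> = (\<Sum>v\<in>UNIV - {v0}. \<theta> $ v *\<^sub>R coord v0 v)"

definition regular_vectors :: "'v::finite \<Rightarrow> (real ^ 'v) set \<Rightarrow> (real ^ 'v) set" where
  "regular_vectors v0 S =
     {\<xi> \<in> dual_a v0. \<forall>T\<subseteq>S. finite T \<and> card T + 1 = CARD('v) - 1 \<longrightarrow> \<xi> \<notin> span T}"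

definition chambers :: "'v::finite \<Rightarrow> (real ^ 'v) set \<Rightarrow> (real ^ 'v) set set" where
  "chambers v0 S = components (regular_vectors v0 S)"

definition partial_sums :: "'a::comm_monoid_add set \<Rightarrow> 'a set" where
  "partial_sums S = {\<Sum>T | T. T \<subseteq> S}"

definition hyperplane :: "'v::finite \<Rightarrow> (real ^ 'v \<Rightarrow> real) \<Rightarrow> real ^ 'v \<Rightarrow> (complex ^ 'v) set" where
  "hyperplane v0 R \<rho> = {u \<in> complex_a v0. pair_complex \<rho> u + of_real (R \<rho>) = 0}"

definition sing_points ::
  "('v::finite, 'e) pre_digraph \<Rightarrow> 'v \<Rightarrow> (real ^ 'v \<Rightarrow> real) \<Rightarrow> (complex ^ 'v) set" where
  "sing_points Q v0 R =
     {x \<in> complex_a v0. \<exists>S\<subseteq>weights Q v0. independent S \<and> CARD('v) - 1 \<le> card S \<and>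
        (\<forall>\<rho>\<in>S. x \<in> hyperplane v0 R \<rho>)}"

definition weights_at ::
  "('v::finite, 'e) pre_digraph \<Rightarrow> 'v \<Rightarrow> (real ^ 'v \<Rightarrow> real) \<Rightarrow> complex ^ 'v \<Rightarrow> (real ^ 'v) set" where
  "weights_at Q v0 R x = {\<rho> \<in> weights Q v0. x \<in> hyperplane v0 R \<rho>}"

text \<open>
  The space of R-charges consists of the extensional functions on the weights,
  with the product topology.
\<close>

definition charge_space :: "('v::finite, 'e) pre_digraph \<Rightarrow> 'v \<Rightarrow> (real ^ 'v \<Rightarrow> real) topology" where
  "charge_space Q v0 = product_topology (\<lambda>_. euclideanreal) (weights Q v0)"

definition generic_charge_cone ::
  "('v::finite, 'e) pre_digraph \<Rightarrow> 'v \<Rightarrow> (real ^ 'v \<Rightarrow> real) set \<Rightarrow> bool" where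
  "generic_charge_cone Q v0 P \<longleftrightarrow>
     openin (charge_space Q v0) P \<and>
     charge_space Q v0 closure_of P = topspace (charge_space Q v0) \<and>
     (\<forall>R\<in>P. \<forall>c>0. (\<lambda>\<rho>\<in>weights Q v0. c * R \<rho>) \<in> P) \<and>
     (\<forall>R\<in>P. \<forall>x\<in>sing_points Q v0 R.
        \<not> (\<exists>S\<subseteq>weights Q v0. card S = CARD('v) \<and> (\<forall>\<rho>\<in>S. x \<in> hyperplane v0 R \<rho>)))"

text \<open>
  Holomorphic means complex differentiable at every point; this is meant for sets \<open>U\<close>
  that are relatively open in \<open>complex_a v0\<close>.
\<close>

definition holomorphic_a ::
  "'v::finite \<Rightarrow> (complex ^ 'v \<Rightarrow> complex) \<Rightarrow> (complex ^ 'v) set \<Rightarrow> bool" where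
  "holomorphic_a v0 f U \<longleftrightarrow>
     (\<forall>u\<in>U. \<exists>L. (f has_derivative L) (at u within complex_a v0) \<and> (\<forall>c w. L (c *s w) = c * L w))"

text \<open>
  A meromorphic function is represented by a total function that is locally a quotient
  \<open>g / h\<close> of holomorphic functions, where \<open>h\<close> does not vanish identically on any nonempty open
  set. The values of the representative at zeros of \<open>h\<close> are not constrained.
\<close>

definition meromorphic_a :: "'v::finite \<Rightarrow> (complex ^ 'v \<Rightarrow> complex) \<Rightarrow> bool" where
  "meromorphic_a v0 f \<longleftrightarrow>
     (\<forall>x\<in>complex_a v0. \<exists>U g h. openin (top_of_set (complex_a v0)) U \<and> x \<in> U \<and>
        holomorphic_a v0 g U \<and> holomorphic_a v0 h U \<and>
        U \<subseteq> closure {u\<in>U. h u \<noteq> 0} \<and> (\<forall>u\<in>U. h u \<noteq> 0 \<longrightarrow> f u = g u / h u))"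

text \<open>
  A function of \<open>z\<^sub>1, \<dots>, z\<^sub>n\<close> takes the list of its arguments, and the residue in the
  first variable is taken first.

  For a quotient \<open>F = g / h\<close> of holomorphic germs, write \<open>h = z\<^sub>1 ^ m * (h\<^sub>m + O(z\<^sub>1))\<close> with a
  nonzero germ \<open>h\<^sub>m\<close> in the other variables. The Laurent coefficients of \<open>F\<close> in \<open>z\<^sub>1\<close> are
  meromorphic germs whose values, wherever \<open>h\<^sub>m \<noteq> 0\<close>, are the Laurent coefficients of the
  one-variable function \<open>z\<^sub>1 \<mapsto> F (z\<^sub>1, \<dots>)\<close>; the coefficient of \<open>1 / z\<^sub>1\<close> is its \<open>residue\<close>
  (cf. \<open>has_laurent_expansion_residue\<close>). The zero set of \<open>h\<^sub>m\<close> is nowhere dense, and for generic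
  values of the later variables it misses a punctured neighbourhood of 0 in the next variable, so
  values there do not affect the subsequent residues. The same holds for the values of a
  representative of \<open>F\<close> at zeros of \<open>h\<close>.
\<close>

primrec iterated_residue :: "nat \<Rightarrow> (complex list \<Rightarrow> complex) \<Rightarrow> complex" where
  "iterated_residue 0 F = F []"
| "iterated_residue (Suc n) F = iterated_residue n (\<lambda>zs. residue (\<lambda>z. F (z # zs)) 0)"

definition point_of_coords :: "'v::finite \<Rightarrow> (real ^ 'v) list \<Rightarrow> complex list \<Rightarrow> complex ^ 'v" where
  "point_of_coords v0 \<gamma> zs =
     (THE u. u \<in> complex_a v0 \<and> (\<forall>i<length \<gamma>. pair_complex (\<gamma> ! i) u = zs ! i))"

definition in_coords ::
  "'v::finite \<Rightarrow> (real ^ 'v) list \<Rightarrow> (complex ^ 'v \<Rightarrow> complex) \<Rightarrow> complex list \<Rightarrow> complex" where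
  "in_coords v0 \<gamma> f = (\<lambda>zs. f (point_of_coords v0 \<gamma> zs))"

definition IR0 :: "'v::finite \<Rightarrow> (real ^ 'v) list \<Rightarrow> (complex ^ 'v \<Rightarrow> complex) \<Rightarrow> complex" where
  "IR0 v0 \<gamma> f = iterated_residue (CARD('v) - 1) (in_coords v0 \<gamma> f)"

text \<open>The wedge product of covectors, as an alternating form on tuples of vectors.\<close>

definition wedge :: "(real ^ 'v::finite) list \<Rightarrow> (real ^ 'v) list \<Rightarrow> real" where
  "wedge \<gamma> us = (\<Sum>p | p permutes {..<length \<gamma>}.
     of_int (sign p) * (\<Prod>i<length \<gamma>. pair_real (\<gamma> ! i) (us ! p i)))"

definition tuples :: "'v::finite \<Rightarrow> (real ^ 'v) list set" where
  "tuples v0 = {us. length us = CARD('v) - 1 \<and> set us \<subseteq> real_a v0}"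

text \<open>The form \<open>d\<mu>\<close> is specified by a basis \<open>fs\<close> chosen from \<open>A\<close>, as \<open>wedge fs\<close>.\<close>

definition frame_in :: "'v::finite \<Rightarrow> (real ^ 'v) set \<Rightarrow> (real ^ 'v) list \<Rightarrow> bool" where
  "frame_in v0 A fs \<longleftrightarrow> set fs \<subseteq> A \<and> is_basis_list v0 fs"

text \<open>A complete flag is the list of its members \<open>F\<^sub>0, \<dots>, F\<^sub>n\<close>.\<close>

definition flags :: "'v::finite \<Rightarrow> (real ^ 'v) set \<Rightarrow> (real ^ 'v) set list set" where
  "flags v0 A = {Fs. length Fs = CARD('v) \<and> Fs ! 0 = {0} \<and> Fs ! (CARD('v) - 1) = dual_a v0 \<and>
     (\<forall>j<CARD('v). dim (Fs ! j) = j \<and> (\<exists>B\<subseteq>A. Fs ! j = span B)) \<and>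
     (\<forall>j<CARD('v) - 1. Fs ! j \<subseteq> Fs ! Suc j)}"

definition kappa :: "(real ^ 'v::finite) set \<Rightarrow> (real ^ 'v) set list \<Rightarrow> nat \<Rightarrow> real ^ 'v" where
  "kappa A Fs j = \<Sum>(A \<inter> Fs ! j)"

definition kappa_list :: "(real ^ 'v::finite) set \<Rightarrow> (real ^ 'v) set list \<Rightarrow> (real ^ 'v) list" where
  "kappa_list A Fs = map (kappa A Fs) [1..<CARD('v)]"

definition nu :: "'v::finite \<Rightarrow> (real ^ 'v) list \<Rightarrow> (real ^ 'v) set \<Rightarrow> (real ^ 'v) set list \<Rightarrow> int" where
  "nu v0 fs A Fs =
     (if \<not> is_basis_list v0 (kappa_list A Fs) then 0
      else if \<exists>c>0. \<forall>us\<in>tuples v0. wedge (kappa_list A Fs) us = c * wedge fs us then 1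
      else -1)"

definition adapted_basis ::
  "'v::finite \<Rightarrow> (real ^ 'v) list \<Rightarrow> (real ^ 'v) set list \<Rightarrow> (real ^ 'v) list \<Rightarrow> bool" where
  "adapted_basis v0 fs Fs \<gamma> \<longleftrightarrow>
     is_basis_list v0 \<gamma> \<and> (\<forall>m<CARD('v). span (set (take m \<gamma>)) = Fs ! m) \<and>
     (\<forall>us\<in>tuples v0. wedge \<gamma> us = wedge fs us)"

definition kappa_cone :: "(real ^ 'v::finite) set \<Rightarrow> (real ^ 'v) set list \<Rightarrow> (real ^ 'v) set" where
  "kappa_cone A Fs = {\<Sum>j=1..CARD('v) - 1. c j *\<^sub>R kappa A Fs j | c. \<forall>j\<in>{1..CARD('v) - 1}. 0 < c j}"

text \<open>
  The residue along a flag \<open>Fs\<close> is computed in the coordinates of a chosen adapted basis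
  \<open>\<gamma> Fs\<close>. The choices of \<open>fs\<close> and \<open>\<gamma>\<close> are explicit parameters.
\<close>

definition JK_res ::
  "'v::finite \<Rightarrow> (real ^ 'v) list \<Rightarrow> ((real ^ 'v) set list \<Rightarrow> (real ^ 'v) list) \<Rightarrow>
   (real ^ 'v) set \<Rightarrow> real ^ 'v \<Rightarrow> (complex ^ 'v \<Rightarrow> complex) \<Rightarrow> complex" where
  "JK_res v0 fs \<gamma> A \<zeta> f =
     (\<Sum>Fs | Fs \<in> flags v0 A \<and> \<zeta> \<in> kappa_cone A Fs. of_int (nu v0 fs A Fs) * IR0 v0 (\<gamma> Fs) f)"

definition JK ::
  "('v::finite, 'e) pre_digraph \<Rightarrow> 'v \<Rightarrow> (real ^ 'v \<Rightarrow> real) \<Rightarrow>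
   (complex ^ 'v \<Rightarrow> (real ^ 'v) list) \<Rightarrow>
   (complex ^ 'v \<Rightarrow> (real ^ 'v) set list \<Rightarrow> (real ^ 'v) list) \<Rightarrow>
   (complex ^ 'v \<Rightarrow> complex) \<Rightarrow> real ^ 'v \<Rightarrow> complex" where
  "JK Q v0 R fs \<gamma> f \<zeta> =
     (\<Sum>x\<in>sing_points Q v0 R. JK_res v0 (fs x) (\<gamma> x) (weights_at Q v0 R x) \<zeta> (\<lambda>u. f (u + x)))"

definition eps_tilde ::
  "('v::finite, 'e) pre_digraph \<Rightarrow> 'v \<Rightarrow> (real ^ 'v \<Rightarrow> real) \<Rightarrow> real ^ 'v \<Rightarrow> complex ^ 'v \<Rightarrow> complex" where
  "eps_tilde Q v0 R \<theta> x =
     (if \<forall>\<rho>\<in>weights_at Q v0 R x.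
           representation (weights_at Q v0 R x) (theta_tilde v0 \<theta>) \<rho> < 0
      then 1 else 0)"

end

theory Submission
  imports Defs "Jordan_Normal_Form.Determinant"
begin

text \<open>
  Fix a singular point \<open>x\<close> and translate it to the origin. Genericity of \<open>R\<close> makes the set \<open>A\<close>
  of weights at \<open>x\<close> a basis of the dual space, and the theorem is an identity between the
  contributions of \<open>x\<close> to both sides. Two ideas give it.

  \<^item> \<^emph>\<open>At most one flag contributes.\<close> A complete flag spanned by elements of a basis \<open>A\<close> is the
    same thing as an ordering \<open>a\<^sub>1, \<dots>, a\<^sub>n\<close> of \<open>A\<close>, and its vectors are the partial sums
    \<open>\<kappa>\<^sub>j = a\<^sub>1 + \<dots> + a\<^sub>j\<close>. By summation by parts, a vector is a positive combination of the \<open>\<kappa>\<^sub>j\<close> iff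
    its coefficients along \<open>a\<^sub>1, \<dots>, a\<^sub>n\<close> are positive and strictly decreasing. Two equal
    coefficients would put \<open>\<zeta>\<close> into the span of \<open>a\<^sub>i + a\<^sub>j\<close> and the other \<open>n - 2\<close> elements of
    \<open>A\<close>, which regularity for sums of weights excludes; so \<open>\<zeta>\<close> lies in exactly one flag cone if
    its coefficients are all positive, and in none otherwise (\<open>JK_res_basis\<close>). A coefficient does
    not vanish on a chamber, which is connected, so its sign for \<open>\<zeta>\<close> is its sign for
    \<open>- theta_tilde\<close> (\<open>chamber_coefficient_sign\<close>).

  \<^item> \<^emph>\<open>The residue along that flag is the iterated residue in the coordinates \<open>A\<close>.\<close> The basis
    \<open>\<gamma>\<close> adapted to the flag is triangular with respect to \<open>a\<^sub>1, \<dots>, a\<^sub>n\<close>. For a function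
    holomorphic off the coordinate hyperplanes, an iterated residue is an iterated integral over
    small circles, whose order can be exchanged, and a circle in one variable may be moved
    slightly off its centre. Exchanging, moving and exchanging back removes an off-diagonal entry
    of the coordinate change (\<open>dir_residue_shear\<close>); what remains is the diagonal, and it divides
    the residue by its product \<open>p\<close> (\<open>IR0_triangular\<close>). The volume normalisation of \<open>\<gamma>\<close> forces
    \<open>p = 1\<close> or \<open>p = -1\<close>, and \<open>p\<close> is precisely the orientation sign \<open>\<nu>\<close> of \<open>\<kappa>\<^sub>1, \<dots>, \<kappa>\<^sub>n\<close>
    (\<open>nu_times_IR0\<close>). Hence sign and determinant cancel. Exchanging the order of integration also
    shows that the ordering of the coordinates is immaterial (\<open>IR0_perm\<close>).
\<close>

no_notation vec_index (infixl "$" 100)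
no_notation fps_nth (infixl "$" 75)

section \<open>Contour integrals depending on a parameter and residues at zero\<close>

lemma continuous_on_contour_integral_param:
  fixes K :: "'a::topological_space \<Rightarrow> complex \<Rightarrow> complex"
  assumes K: "continuous_on (U \<times> path_image g) (\<lambda>(u, t). K u t)"
    and g: "valid_path g" "continuous_on {0..1} (\<lambda>x. vector_derivative g (at x))"
  shows "continuous_on U (\<lambda>u. contour_integral g (K u))"
proof -
  have 1: "continuous_on (U \<times> cbox 0 1) (\<lambda>p. K (fst p) (g (snd p)))"
  proof -
    have gc: "continuous_on (U \<times> {0..1}) (\<lambda>p. g (snd p))"
      by (rule continuous_on_compose2[OF valid_path_imp_path[OF g(1), unfolded path_def]
            continuous_on_snd[OF continuous_on_id]]) auto
    have "continuous_on (U \<times> cbox 0 1) (\<lambda>p. (case (fst p, g (snd p)) of (u, t) \<Rightarrow> K u t))"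
      by (rule continuous_on_compose2[OF K])
         (use gc in \<open>auto intro!: continuous_intros simp: path_image_def o_def\<close>)
    then show ?thesis by simp
  qed
  have 2: "continuous_on (U \<times> cbox 0 1) (\<lambda>p. vector_derivative g (at (snd p)))"
    by (rule continuous_on_compose2[OF g(2)]) (auto intro!: continuous_intros)
  have "continuous_on (U \<times> cbox 0 1) (\<lambda>(u, x). K u (g x) * vector_derivative g (at x))"
    using continuous_on_mult[OF 1 2] by (simp add: case_prod_unfold)
  from integral_continuous_on_param[OF this] show ?thesis
    by (simp add: contour_integral_integral)
qed

lemma vector_derivative_circlepath_continuous:
  "continuous_on A (\<lambda>x. vector_derivative (circlepath z r) (at x))"
  by (simp add: vector_derivative_circlepath) (intro continuous_intros)

text \<open>
  Morera: the integral over a triangle can be moved inside the integral over \<open>g\<close>, where it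
  vanishes by Cauchy's theorem.
\<close>

lemma holomorphic_on_contour_integral_param:
  assumes U: "open U"
    and K: "continuous_on (U \<times> path_image g) (\<lambda>(s, t). K s t)"
    and hol: "\<And>t. t \<in> path_image g \<Longrightarrow> (\<lambda>s. K s t) holomorphic_on U"
    and g: "valid_path g" "continuous_on {0..1} (\<lambda>x. vector_derivative g (at x))"
  shows "(\<lambda>s. contour_integral g (K s)) holomorphic_on U"
proof -
  have "(\<lambda>s. contour_integral g (K s)) analytic_on U"
  proof (rule Morera_triangle[OF _ U], safe)
    show "continuous_on U (\<lambda>s. contour_integral g (K s))"
      by (rule continuous_on_contour_integral_param[OF K g])
  next
    fix a b c assume abc: "convex hull {a, b, c} \<subseteq> U"
    have seg: "closed_segment a b \<subseteq> U" "closed_segment b c \<subseteq> U" "closed_segment c a \<subseteq> U"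
      using abc hull_mono[of "{a,b}" "{a,b,c}" convex] hull_mono[of "{b,c}" "{a,b,c}" convex]
        hull_mono[of "{c,a}" "{a,b,c}" convex] by (auto simp: segment_convex_hull)
    have swap: "contour_integral (linepath p q) (\<lambda>s. contour_integral g (K s)) =
        contour_integral g (\<lambda>t. contour_integral (linepath p q) (\<lambda>s. K s t))"
      and int: "(\<lambda>t. contour_integral (linepath p q) (\<lambda>s. K s t)) contour_integrable_on g"
      if "closed_segment p q \<subseteq> U" for p q
    proof -
      have c: "continuous_on (path_image (linepath p q) \<times> path_image g) (\<lambda>(s, t). K s t)"
        by (rule continuous_on_subset[OF K]) (use that in auto)
      show "contour_integral (linepath p q) (\<lambda>s. contour_integral g (K s)) =
          contour_integral g (\<lambda>t. contour_integral (linepath p q) (\<lambda>s. K s t))"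
        by (rule contour_integral_swap[OF c]) (use g in auto)
      have "continuous_on (path_image g \<times> path_image (linepath p q)) (\<lambda>(t, s). K s t)"
      proof -
        have "continuous_on (path_image g \<times> path_image (linepath p q))
            (\<lambda>x. (case (snd x, fst x) of (s, t) \<Rightarrow> K s t))"
          by (rule continuous_on_compose2[OF c]) (auto intro!: continuous_intros)
        then show ?thesis by (simp add: case_prod_unfold)
      qed
      then have "continuous_on (path_image g)
          (\<lambda>t. contour_integral (linepath p q) (\<lambda>s. K s t))"
        by (rule continuous_on_contour_integral_param) auto
      then show "(\<lambda>t. contour_integral (linepath p q) (\<lambda>s. K s t)) contour_integrable_on g"
        unfolding contour_integrable_on
        by (intro integrable_continuous_real continuous_on_mult
            continuous_on_compose2[OF _ valid_path_imp_path[OF g(1), unfolded path_def]] g)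
           (auto simp: path_image_def)
    qed
    have "contour_integral (linepath a b) (\<lambda>s. K s t) + contour_integral (linepath b c) (\<lambda>s. K s t)
        + contour_integral (linepath c a) (\<lambda>s. K s t) = 0" if t: "t \<in> path_image g" for t
    proof -
      have "(\<lambda>s. K s t) holomorphic_on convex hull {a, b, c}"
        using hol[OF t] abc holomorphic_on_subset by blast
      from Cauchy_theorem_triangle[OF this] show ?thesis
        using has_chain_integral_chain_integral3 by blast
    qed
    then have "contour_integral g (\<lambda>t. contour_integral (linepath a b) (\<lambda>s. K s t)
        + contour_integral (linepath b c) (\<lambda>s. K s t)
        + contour_integral (linepath c a) (\<lambda>s. K s t)) = contour_integral g (\<lambda>_. 0)"
      by (intro contour_integral_eq) auto
    then show "contour_integral (linepath a b) (\<lambda>s. contour_integral g (K s)) +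
        contour_integral (linepath b c) (\<lambda>s. contour_integral g (K s)) +
        contour_integral (linepath c a) (\<lambda>s. contour_integral g (K s)) = 0"
      by (simp add: swap seg int contour_integral_add contour_integrable_add)
  qed
  then show ?thesis by (rule analytic_imp_holomorphic)
qed

text \<open>
  The circle need not be centred at the singularity. This is what makes shears harmless: a
  shear of the variables moves the centre of a circle of integration.
\<close>

lemma contour_integral_eccentric_circle:
  assumes hol: "\<phi> holomorphic_on ball 0 \<eta> - {0}" and "cmod p < \<rho>" "cmod p + \<rho> < \<eta>"
  shows "contour_integral (circlepath p \<rho>) \<phi> = 2 * pi * \<i> * residue \<phi> 0"
proof -
  have \<rho>: "0 < \<rho>" using assms(2) norm_ge_zero[of p] by linarith
  have sub: "path_image (circlepath p \<rho>) \<subseteq> ball 0 \<eta> - {0}"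
  proof
    fix z assume "z \<in> path_image (circlepath p \<rho>)"
    then have z: "cmod (z - p) = \<rho>" using \<rho> by (simp add: dist_norm norm_minus_commute)
    have "cmod z \<le> cmod (z - p) + cmod p" using norm_triangle_ineq[of "z - p" p] by simp
    then show "z \<in> ball 0 \<eta> - {0}" using z assms by auto
  qed
  have "contour_integral (circlepath p \<rho>) \<phi> = 2 * pi * \<i> *
      (\<Sum>q\<in>{0}. winding_number (circlepath p \<rho>) q * residue \<phi> q)"
  proof (rule Residue_theorem[OF _ _ _ hol _ _ sub])
    show "\<forall>z. z \<notin> ball 0 \<eta> \<longrightarrow> winding_number (circlepath p \<rho>) z = 0"
      using sub by (auto intro!: winding_number_zero_outside[of _ "ball 0 \<eta>"])
  qed auto
  moreover have "winding_number (circlepath p \<rho>) 0 = 1"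
    by (rule winding_number_circlepath) (use assms in simp)
  ultimately show ?thesis by simp
qed

text \<open>
  The scaling factor is complex, so the image of a circle is a rotated circle, which is not a
  \<open>circlepath\<close>; it has to be treated as a composite path.
\<close>

lemma contour_integral_scaled_circlepath:
  "contour_integral ((*) c \<circ> circlepath 0 \<rho>) \<phi> =
    contour_integral (circlepath 0 \<rho>) (\<lambda>t. \<phi> (c * t) * c)"
proof -
  have "vector_derivative ((*) c \<circ> circlepath 0 \<rho>) (at x) =
      c * vector_derivative (circlepath 0 \<rho>) (at x)" for x
    unfolding o_def vector_derivative_circlepath
    by (intro vector_derivative_at has_vector_derivative_mult_right has_vector_derivative_circlepath)
  then show ?thesis by (simp add: contour_integral_integral mult_ac)
qed

lemma residue_scale:
  assumes hol: "\<phi> holomorphic_on ball 0 \<eta> - {0}" and \<eta>: "0 < \<eta>" and c: "c \<noteq> 0"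
  shows "residue (\<lambda>t. \<phi> (c * t)) 0 = residue \<phi> 0 / c"
proof -
  define \<rho> where "\<rho> = \<eta> / (2 * cmod c)"
  have \<rho>: "0 < \<rho>" using \<eta> c by (simp add: \<rho>_def)
  let ?g = "circlepath 0 \<rho>" and ?cg = "(*) c \<circ> circlepath 0 \<rho>"
  have hol': "(\<lambda>t. \<phi> (c * t)) holomorphic_on ball 0 (\<eta> / cmod c) - {0}"
    by (rule holomorphic_on_compose_gen[OF _ hol, unfolded o_def])
       (use c in \<open>auto intro!: holomorphic_intros simp: norm_mult field_simps\<close>)
  have 1: "contour_integral ?g (\<lambda>t. \<phi> (c * t)) = 2 * pi * \<i> * residue (\<lambda>t. \<phi> (c * t)) 0"
    by (rule contour_integral_eccentric_circle[OF hol']) (use \<rho> \<eta> c in \<open>auto simp: \<rho>_def field_simps\<close>)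
  have sub: "path_image ?cg \<subseteq> ball 0 \<eta> - {0}"
    using \<rho> \<eta> c by (auto simp: path_image_compose norm_mult \<rho>_def)
  have vp: "valid_path ?cg"
    by (rule valid_path_compose_holomorphic[of _ _ UNIV]) (auto intro: holomorphic_intros)
  have closed: "pathfinish ?cg = pathstart ?cg"
    by (simp add: pathfinish_compose pathstart_compose)
  have "winding_number ?cg 0 = winding_number ?g 0"
  proof -
    have "winding_number ?cg 0 = 1 / (2 * pi * \<i>) * contour_integral ?cg (\<lambda>w. 1 / w)"
      using winding_number_valid_path[OF vp] sub by force
    also have "contour_integral ?cg (\<lambda>w. 1 / w) = contour_integral ?g (\<lambda>w. 1 / w)"
      using c by (simp add: contour_integral_scaled_circlepath)
    also have "1 / (2 * pi * \<i>) * \<dots> = winding_number ?g 0"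
      using winding_number_valid_path[of ?g 0] \<rho> by simp
    finally show ?thesis .
  qed
  then have wn: "winding_number ?cg 0 = 1"
    using \<rho> by (simp add: winding_number_circlepath_centre)
  have "contour_integral ?cg \<phi> = 2 * pi * \<i> * (\<Sum>q\<in>{0}. winding_number ?cg q * residue \<phi> q)"
  proof (rule Residue_theorem[OF _ _ _ hol vp closed sub])
    show "\<forall>z. z \<notin> ball 0 \<eta> \<longrightarrow> winding_number ?cg z = 0"
      using sub closed valid_path_imp_path[OF vp]
      by (auto intro!: winding_number_zero_outside[of _ "ball 0 \<eta>"])
  qed auto
  then have 2: "contour_integral ?cg \<phi> = 2 * pi * \<i> * residue \<phi> 0" using wn by simp
  have "contour_integral ?cg \<phi> = contour_integral ?g (\<lambda>t. \<phi> (c * t)) * c"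
  proof -
    have "(\<lambda>t. \<phi> (c * t)) contour_integrable_on ?g"
      by (rule contour_integrable_holomorphic_simple[OF hol'])
         (use \<rho> \<eta> c in \<open>auto simp: \<rho>_def field_simps\<close>)
    then show ?thesis by (simp add: contour_integral_scaled_circlepath contour_integral_rmul)
  qed
  then show ?thesis using 1 2 c by (simp add: field_simps)
qed

section \<open>Residues along a direction\<close>

lemma pair_complex_add [simp]: "pair_complex a (u + v) = pair_complex a u + pair_complex a v"
  by (simp add: pair_complex_def distrib_left sum.distrib)

lemma pair_complex_diff [simp]: "pair_complex a (u - v) = pair_complex a u - pair_complex a v"
  by (simp add: pair_complex_def right_diff_distrib sum_subtractf)

lemma pair_complex_scale [simp]: "pair_complex a (c *s u) = c * pair_complex a u"
  by (simp add: pair_complex_def sum_distrib_left mult_ac)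

lemma pair_complex_zero [simp]: "pair_complex a 0 = 0"
  by (simp add: pair_complex_def)

lemma pair_complex_sum: "pair_complex b (\<Sum>a\<in>I. g a) = (\<Sum>a\<in>I. pair_complex b (g a))"
  by (induction I rule: infinite_finite_induct) auto

lemma continuous_on_pair_complex [continuous_intros]:
  "continuous_on S f \<Longrightarrow> continuous_on S (\<lambda>x. pair_complex a (f x))"
  unfolding pair_complex_def by (intro continuous_intros)

lemma continuous_on_vector_scale [continuous_intros]:
  fixes v :: "'a::topological_space \<Rightarrow> complex ^ 'v::finite"
  assumes "continuous_on S c" "continuous_on S v"
  shows "continuous_on S (\<lambda>x. c x *s v x)"
  unfolding vector_scalar_mult_def using assms by (intro continuous_intros)

text \<open>
  A set \<open>B\<close> of covectors serves as a coordinate system and \<open>J\<close> is the set of coordinates that are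
  still free: taking a residue sets one more coordinate to zero and removes it from \<open>J\<close>. In this
  way all the functions that arise live on subsets of one vector space.
\<close>

definition coord_subspace :: "(real ^ 'v::finite) set \<Rightarrow> (real ^ 'v) set \<Rightarrow> (complex ^ 'v) set" where
  "coord_subspace B J = {u. \<forall>a\<in>B - J. pair_complex a u = 0}"

text \<open>
  The polydisc of radius \<open>r\<close> in the free coordinates, without the coordinate hyperplanes.
\<close>

definition punctured :: "(real ^ 'v::finite) set \<Rightarrow> (real ^ 'v) set \<Rightarrow> real \<Rightarrow> (complex ^ 'v) set" where
  "punctured B J r =
     {u \<in> coord_subspace B J. \<forall>a\<in>J. pair_complex a u \<noteq> 0 \<and> cmod (pair_complex a u) < r}"

text \<open>
  Holomorphy is required along all complex lines and not only along the coordinate axes: a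
  residue in a direction oblique to the axes is a contour integral along such a line. Together with
  joint continuity, this is a property that survives taking residues
  (\<open>holomorphic_punctured_dir_residue\<close>), and it is all that contour integrals need.
\<close>

definition holomorphic_punctured ::
  "(real ^ 'v::finite) set \<Rightarrow> (real ^ 'v) set \<Rightarrow> real \<Rightarrow> (complex ^ 'v \<Rightarrow> complex) \<Rightarrow> bool" where
  "holomorphic_punctured B J r F \<longleftrightarrow> continuous_on (punctured B J r) F \<and>
     (\<forall>u\<in>coord_subspace B J. \<forall>v\<in>coord_subspace B J.
        (\<lambda>t. F (u + t *s v)) holomorphic_on {t. u + t *s v \<in> punctured B J r})"

definition dir_residue :: "complex ^ 'v::finite \<Rightarrow> (complex ^ 'v \<Rightarrow> complex) \<Rightarrow> complex ^ 'v \<Rightarrow> complex" where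
  "dir_residue w F u = residue (\<lambda>t. F (u + t *s w)) 0"

lemma coord_subspace_add: "u \<in> coord_subspace B J \<Longrightarrow> v \<in> coord_subspace B J \<Longrightarrow> u + v \<in> coord_subspace B J"
  and coord_subspace_scale: "u \<in> coord_subspace B J \<Longrightarrow> c *s u \<in> coord_subspace B J"
  by (auto simp: coord_subspace_def)

lemma coord_subspace_mono: "u \<in> coord_subspace B I \<Longrightarrow> I \<subseteq> J \<Longrightarrow> u \<in> coord_subspace B J"
  by (auto simp: coord_subspace_def)

lemma coord_subspace_Diff:
  "u \<in> coord_subspace B J \<Longrightarrow> pair_complex a u = 0 \<Longrightarrow> u \<in> coord_subspace B (J - {a})"
  by (auto simp: coord_subspace_def)

lemma holomorphic_punctured_line:
  assumes "holomorphic_punctured B J r F" "u \<in> coord_subspace B J" "v \<in> coord_subspace B J"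
    and "\<And>t. t \<in> T \<Longrightarrow> u + t *s v \<in> punctured B J r"
  shows "(\<lambda>t. F (u + t *s v)) holomorphic_on T"
proof (rule holomorphic_on_subset)
  show "(\<lambda>t. F (u + t *s v)) holomorphic_on {t. u + t *s v \<in> punctured B J r}"
    using assms(1-3) by (simp add: holomorphic_punctured_def)
qed (use assms(4) in auto)

text \<open>
  The conditions on the coordinates are open, so they persist when the base point and two small
  multiples of directions are varied together. Taking one of the directions or multiples to be zero
  gives the simpler cases.
\<close>

lemma coordinates_nearby:
  fixes u0 :: "complex ^ 'v::finite"
  assumes J: "finite J" and u0: "\<And>a. a \<in> J \<Longrightarrow> pair_complex a u0 \<noteq> 0 \<and> cmod (pair_complex a u0) < r"
  obtains \<delta> where "\<delta> > 0" "\<And>u s t a. dist u u0 < \<delta> \<Longrightarrow> cmod s < \<delta> \<Longrightarrow> cmod t < \<delta> \<Longrightarrow> a \<in> J \<Longrightarrow>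
      pair_complex a (u + t *s w + s *s v) \<noteq> 0 \<and> cmod (pair_complex a (u + t *s w + s *s v)) < r"
proof -
  let ?f = "\<lambda>a (p :: (complex ^ 'v) \<times> complex \<times> complex).
      pair_complex a (fst p + snd (snd p) *s w + fst (snd p) *s v)"
  have "\<forall>\<^sub>F p in nhds (u0, 0, 0). \<forall>a\<in>J. ?f a p \<noteq> 0 \<and> cmod (?f a p) < r"
  proof (intro eventually_ball_finite J ballI eventually_conj)
    fix a assume a: "a \<in> J"
    have cont: "continuous_on UNIV (?f a)"
      by (intro continuous_on_pair_complex continuous_on_add continuous_on_vector_scale
          continuous_on_fst continuous_on_snd continuous_on_id continuous_on_const)
    have "open {p. ?f a p \<noteq> 0}"
      by (rule open_Collect_neq) (intro continuous_on_const cont)+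
    from eventually_nhds_in_open[OF this, of "(u0, 0, 0)"] show "\<forall>\<^sub>F p in nhds (u0, 0, 0). ?f a p \<noteq> 0"
      using u0[OF a] by simp
    have "open {p. cmod (?f a p) < r}"
      by (rule open_Collect_less) (intro continuous_on_norm continuous_on_const cont)+
    from eventually_nhds_in_open[OF this, of "(u0, 0, 0)"] show "\<forall>\<^sub>F p in nhds (u0, 0, 0). cmod (?f a p) < r"
      using u0[OF a] by simp
  qed
  then obtain d where d: "d > 0" "\<And>p a. dist p (u0, 0, 0) < d \<Longrightarrow> a \<in> J \<Longrightarrow> ?f a p \<noteq> 0 \<and> cmod (?f a p) < r"
    unfolding eventually_nhds_metric by blast
  show ?thesis
  proof (rule that[of "d / 3"])
    fix u s t a assume *: "dist u u0 < d / 3" "cmod s < d / 3" "cmod t < d / 3" "a \<in> J"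
    have "dist (u, s, t) (u0, 0, 0) \<le> dist u u0 + dist (s, t) (0, 0)"
      unfolding dist_Pair_Pair[of u] by (rule sqrt_sum_squares_le_sum) auto
    also have "dist (s, t) (0, 0) \<le> cmod s + cmod t"
      unfolding dist_Pair_Pair by (rule order.trans[OF sqrt_sum_squares_le_sum]) auto
    finally have "dist (u, s, t) (u0, 0, 0) < d" using * by simp
    from d(2)[OF this *(4)]
    show "pair_complex a (u + t *s w + s *s v) \<noteq> 0 \<and> cmod (pair_complex a (u + t *s w + s *s v)) < r"
      by simp
  qed (use d in auto)
qed

text \<open>
  Near \<open>u0\<close> one radius \<open>\<rho>\<close> serves for all base points. The residue at varying base points is
  then an integral over one fixed circle, and its regularity can be read off the integrand.
\<close>

lemma dir_residue_local:
  assumes J: "finite J" "a \<in> J" "a \<in> B" and r: "r > 0"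
    and w: "w \<in> coord_subspace B J" "pair_complex a w \<noteq> 0"
    and u0: "u0 \<in> punctured B (J - {a}) r"
  obtains \<delta> \<rho> where "\<delta> > 0" "\<rho> > 0"
    "\<And>u t. u \<in> coord_subspace B (J - {a}) \<Longrightarrow> dist u u0 < \<delta> \<Longrightarrow> t \<noteq> 0 \<Longrightarrow> cmod t < \<rho> \<Longrightarrow>
       u + t *s w \<in> punctured B J r"
proof -
  obtain \<delta> where \<delta>: "\<delta> > 0" "\<And>u s t b. dist u u0 < \<delta> \<Longrightarrow> cmod s < \<delta> \<Longrightarrow> cmod t < \<delta> \<Longrightarrow> b \<in> J - {a} \<Longrightarrow>
      pair_complex b (u + t *s w + s *s 0) \<noteq> 0 \<and> cmod (pair_complex b (u + t *s w + s *s 0)) < r"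
    by (rule coordinates_nearby[of "J - {a}" u0 r w 0]) (use J u0 in \<open>auto simp: punctured_def\<close>)
  define \<rho> where "\<rho> = min \<delta> (r / cmod (pair_complex a w))"
  show ?thesis
  proof (rule that[of \<delta> \<rho>])
    show "\<rho> > 0" using \<delta> w r by (simp add: \<rho>_def)
    fix u t assume u: "u \<in> coord_subspace B (J - {a})" "dist u u0 < \<delta>" and t: "t \<noteq> 0" "cmod t < \<rho>"
    have "pair_complex a u = 0" using u(1) J by (auto simp: coord_subspace_def)
    then have "pair_complex a (u + t *s w) = t * pair_complex a w" by simp
    moreover have "cmod (t * pair_complex a w) < r"
      using t w by (simp add: \<rho>_def norm_mult field_simps)
    moreover have "u + t *s w \<in> coord_subspace B J"
      by (intro coord_subspace_add coord_subspace_scale w coord_subspace_mono[OF u(1)]) auto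
    moreover have "pair_complex b (u + t *s w) \<noteq> 0 \<and> cmod (pair_complex b (u + t *s w)) < r"
      if "b \<in> J" "b \<noteq> a" for b
      using \<delta>(2)[OF u(2), of 0 t b] \<delta>(1) t that by (simp add: \<rho>_def)
    moreover have "t * pair_complex a w \<noteq> 0" using t(1) w(2) by simp
    ultimately have "\<forall>b\<in>J. pair_complex b (u + t *s w) \<noteq> 0 \<and> cmod (pair_complex b (u + t *s w)) < r"
      by metis
    with \<open>u + t *s w \<in> coord_subspace B J\<close> show "u + t *s w \<in> punctured B J r"
      by (simp add: punctured_def)
  qed (use \<delta> in auto)
qed

lemma dir_residue_contour:
  assumes F: "holomorphic_punctured B J r F" and uw: "u \<in> coord_subspace B J" "w \<in> coord_subspace B J"
    and t: "\<And>t. t \<noteq> 0 \<Longrightarrow> cmod t < \<eta> \<Longrightarrow> u + t *s w \<in> punctured B J r"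
    and \<rho>: "0 < \<rho>" "\<rho> < \<eta>"
  shows "dir_residue w F u = contour_integral (circlepath 0 \<rho>) (\<lambda>t. F (u + t *s w)) / (2 * pi * \<i>)"
proof -
  have "(\<lambda>t. F (u + t *s w)) holomorphic_on ball 0 \<eta> - {0}"
    by (rule holomorphic_punctured_line[OF F uw]) (use t in auto)
  from contour_integral_eccentric_circle[OF this, of 0 \<rho>] show ?thesis
    using \<rho> by (simp add: dir_residue_def)
qed

lemma holomorphic_punctured_dir_residue:
  assumes F: "holomorphic_punctured B J r F" and J: "finite J" "a \<in> J" "a \<in> B" and r: "r > 0"
    and w: "w \<in> coord_subspace B J" "pair_complex a w \<noteq> 0"
  shows "holomorphic_punctured B (J - {a}) r (dir_residue w F)"
  unfolding holomorphic_punctured_def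
proof (intro conjI ballI)
  let ?S = "coord_subspace B (J - {a})" and ?P = "punctured B (J - {a}) r"
  have SJ: "u \<in> coord_subspace B J" if "u \<in> ?S" for u by (rule coord_subspace_mono[OF that]) auto
  have contF: "continuous_on (punctured B J r) F"
    using F by (simp add: holomorphic_punctured_def)
  show "continuous_on ?P (dir_residue w F)"
    unfolding continuous_on_eq_continuous_within
  proof
    fix u0 assume u0: "u0 \<in> ?P"
    obtain \<delta> \<rho> where \<delta>: "\<delta> > 0" "\<rho> > 0"
      and t: "\<And>u t. u \<in> ?S \<Longrightarrow> dist u u0 < \<delta> \<Longrightarrow> t \<noteq> 0 \<Longrightarrow> cmod t < \<rho> \<Longrightarrow> u + t *s w \<in> punctured B J r"
      using dir_residue_local[OF J r w u0] by blast
    let ?N = "?P \<inter> ball u0 \<delta>"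
    have eq: "dir_residue w F u = contour_integral (circlepath 0 (\<rho>/2)) (\<lambda>t. F (u + t *s w)) / (2 * pi * \<i>)"
      if "u \<in> ?N" for u
    proof -
      have "u \<in> ?S" "dist u u0 < \<delta>" using that by (auto simp: punctured_def dist_commute)
      then show ?thesis
        by (intro dir_residue_contour[OF F SJ w(1) t]) (use \<delta> in auto)
    qed
    have in_P: "u + t *s w \<in> punctured B J r" if "u \<in> ?N" "t \<in> path_image (circlepath 0 (\<rho>/2))" for u t
      by (rule t) (use that \<delta> in \<open>auto simp: punctured_def dist_commute\<close>)
    have "continuous_on (?N \<times> path_image (circlepath 0 (\<rho>/2))) (\<lambda>p. F (fst p + snd p *s w))"
      by (rule continuous_on_compose2[OF contF])
         (use in_P in \<open>auto intro!: continuous_intros simp del: path_image_circlepath\<close>)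
    then have "continuous_on ?N (\<lambda>u. contour_integral (circlepath 0 (\<rho>/2)) (\<lambda>t. F (u + t *s w)))"
      by (intro continuous_on_contour_integral_param vector_derivative_circlepath_continuous)
        (auto simp: case_prod_unfold)
    then have "continuous_on ?N (\<lambda>u. contour_integral (circlepath 0 (\<rho>/2)) (\<lambda>t. F (u + t *s w)) / (2 * pi * \<i>))"
      by (intro continuous_intros) auto
    then have "continuous_on ?N (dir_residue w F)"
      by (subst continuous_on_cong[OF refl eq])
    then have "continuous (at u0 within ?N) (dir_residue w F)"
      using u0 \<delta> by (auto simp: continuous_on_eq_continuous_within)
    moreover have "at u0 within ?N = at u0 within ?P"
      by (rule at_within_nhd[of _ "ball u0 \<delta>"]) (use \<delta> in auto)
    ultimately show "continuous (at u0 within ?P) (dir_residue w F)" by simp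
  qed
  fix u v assume u: "u \<in> ?S" and v: "v \<in> ?S"
  show "(\<lambda>s. dir_residue w F (u + s *s v)) holomorphic_on {s. u + s *s v \<in> ?P}"
    unfolding holomorphic_on_def
  proof
    fix s0 assume "s0 \<in> {s. u + s *s v \<in> ?P}"
    then have u0: "u + s0 *s v \<in> ?P" by simp
    obtain \<delta> \<rho> where \<delta>: "\<delta> > 0" "\<rho> > 0"
      and t: "\<And>u' t. u' \<in> ?S \<Longrightarrow> dist u' (u + s0 *s v) < \<delta> \<Longrightarrow> t \<noteq> 0 \<Longrightarrow> cmod t < \<rho> \<Longrightarrow>
        u' + t *s w \<in> punctured B J r"
      using dir_residue_local[OF J r w u0] by blast
    have "continuous (at s0) (\<lambda>s. u + s *s v)"
      using continuous_on_eq_continuous_at[of UNIV "\<lambda>s. u + s *s v"] by (force intro: continuous_intros)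
    then obtain d where d: "d > 0" "\<And>s. dist s s0 < d \<Longrightarrow> dist (u + s *s v) (u + s0 *s v) < \<delta>"
      using \<delta>(1) unfolding continuous_at_eps_delta dist_norm by blast
    let ?U = "ball s0 d" and ?g = "circlepath 0 (\<rho>/2)"
    have S: "u + s *s v \<in> ?S" for s by (intro coord_subspace_add coord_subspace_scale u v)
    have in_P: "u + s *s v + t *s w \<in> punctured B J r" if "s \<in> ?U" "t \<in> path_image ?g" for s t
      by (rule t[OF S d(2)]) (use that \<delta> in \<open>auto simp: dist_commute\<close>)
    have eq: "dir_residue w F (u + s *s v) =
        contour_integral ?g (\<lambda>t. F (u + s *s v + t *s w)) / (2 * pi * \<i>)" if "s \<in> ?U" for s
      by (rule dir_residue_contour[OF F SJ[OF S] w(1) t[OF S d(2)]]) (use that \<delta> in \<open>auto simp: dist_commute\<close>)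
    have "(\<lambda>s. contour_integral ?g (\<lambda>t. F (u + s *s v + t *s w))) holomorphic_on ?U"
    proof (rule holomorphic_on_contour_integral_param)
      have "continuous_on (?U \<times> path_image ?g) (\<lambda>p. F (u + fst p *s v + snd p *s w))"
        by (rule continuous_on_compose2[OF contF])
           (use in_P in \<open>auto intro!: continuous_intros simp del: path_image_circlepath mem_ball\<close>)
      then show "continuous_on (?U \<times> path_image ?g) (\<lambda>(s, t). F (u + s *s v + t *s w))"
        by (simp add: case_prod_unfold)
      fix t assume t: "t \<in> path_image ?g"
      \<comment> \<open>For fixed \<open>t\<close> this is a line parallel to \<open>v\<close> through the displaced point \<open>u + t *s w\<close>.\<close>
    have "(\<lambda>s. F ((u + t *s w) + s *s v)) holomorphic_on ?U"
        by (rule holomorphic_punctured_line[OF F])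
           (use in_P[OF _ t] in \<open>auto intro!: coord_subspace_add coord_subspace_scale SJ[OF u] SJ[OF v] w simp: add_ac\<close>)
      then show "(\<lambda>s. F (u + s *s v + t *s w)) holomorphic_on ?U" by (simp add: add_ac)
    qed (auto intro: vector_derivative_circlepath_continuous)
    then have "(\<lambda>s. contour_integral ?g (\<lambda>t. F (u + s *s v + t *s w)) / (2 * pi * \<i>)) holomorphic_on ?U"
      by (intro holomorphic_intros) auto
    then have "(\<lambda>s. dir_residue w F (u + s *s v)) holomorphic_on ?U"
      by (subst holomorphic_cong[OF refl eq])
    then have "(\<lambda>s. dir_residue w F (u + s *s v)) field_differentiable at s0"
      using d(1) holomorphic_on_imp_differentiable_at by force
    then show "(\<lambda>s. dir_residue w F (u + s *s v)) field_differentiable at s0 within {s. u + s *s v \<in> ?P}"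
      by (rule field_differentiable_at_within)
  qed
qed

text \<open>
  Write \<open>Q s t\<close> for the value of \<open>F\<close> at \<open>u + t w1 + s w2\<close>. The left side is the integral of
  \<open>Q (s + c t) t\<close>, first over a small circle in \<open>t\<close>, then over a larger one in \<open>s\<close>. Exchange the two
  integrals. For fixed \<open>t\<close>, the inner integral is now over a circle in \<open>s + c t\<close> whose centre \<open>c t\<close>
  is so close to \<open>0\<close> that the singularity is still inside. So it is the residue of \<open>Q\<close> in the
  variable \<open>s\<close>, and \<open>c\<close> has disappeared. Taking \<open>c = 0\<close> shows that residues commute, and comparing
  with \<open>c = 0\<close> shows that the shear has no effect.
\<close>

lemma dir_residue_shear:
  assumes F: "holomorphic_punctured B J r F" and J: "finite J" "a \<in> J" "b \<in> J" "a \<noteq> b" "J \<subseteq> B"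
    and r: "r > 0"
    and w1: "w1 \<in> coord_subspace B J" "pair_complex a w1 \<noteq> 0" "pair_complex b w1 = 0"
    and w2: "w2 \<in> coord_subspace B J" "pair_complex b w2 \<noteq> 0" "pair_complex a w2 = 0"
    and u: "u \<in> punctured B (J - {a, b}) r"
  shows "dir_residue w2 (dir_residue (w1 + c *s w2) F) u = dir_residue w1 (dir_residue w2 F) u"
proof -
  obtain \<delta> where \<delta>: "\<delta> > 0" "\<And>u' s t b'. dist u' u < \<delta> \<Longrightarrow> cmod s < \<delta> \<Longrightarrow> cmod t < \<delta> \<Longrightarrow> b' \<in> J - {a,b} \<Longrightarrow>
      pair_complex b' (u' + t *s w1 + s *s w2) \<noteq> 0 \<and> cmod (pair_complex b' (u' + t *s w1 + s *s w2)) < r"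
    by (rule coordinates_nearby[of "J - {a,b}" u r w1 w2]) (use J u in \<open>auto simp: punctured_def\<close>)
  define \<eta> where "\<eta> = min \<delta> (min (r / cmod (pair_complex a w1)) (r / cmod (pair_complex b w2)))"
  have \<eta>: "\<eta> > 0" "\<eta> \<le> \<delta>" "\<eta> * cmod (pair_complex a w1) \<le> r" "\<eta> * cmod (pair_complex b w2) \<le> r"
  proof -
    show "\<eta> > 0" "\<eta> \<le> \<delta>" using \<delta>(1) r w1 w2 by (simp_all add: \<eta>_def)
    have "\<eta> \<le> r / cmod (pair_complex a w1)" "\<eta> \<le> r / cmod (pair_complex b w2)"
      by (simp_all add: \<eta>_def)
    then show "\<eta> * cmod (pair_complex a w1) \<le> r" "\<eta> * cmod (pair_complex b w2) \<le> r"
      using w1 w2 by (simp_all add: pos_le_divide_eq)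
  qed
  have uS: "u \<in> coord_subspace B (J - {a, b})" using u by (simp add: punctured_def)
  have uJ: "u \<in> coord_subspace B J" by (rule coord_subspace_mono[OF uS]) auto
  have uab: "pair_complex a u = 0" "pair_complex b u = 0"
    using uS J by (auto simp: coord_subspace_def)
  have gen: "cmod (t * pair_complex a w1) < r" "cmod (s * pair_complex b w2) < r"
    if "cmod t < \<eta>" "cmod s < \<eta>" for s t
  proof -
    have "cmod t * cmod (pair_complex a w1) < \<eta> * cmod (pair_complex a w1)"
      "cmod s * cmod (pair_complex b w2) < \<eta> * cmod (pair_complex b w2)"
      using that w1 w2 by auto
    then show "cmod (t * pair_complex a w1) < r" "cmod (s * pair_complex b w2) < r"
      using \<eta> by (auto simp: norm_mult)
  qed
  have oth: "pair_complex b' u + t * pair_complex b' w1 + s * pair_complex b' w2 \<noteq> 0 \<and>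
      cmod (pair_complex b' u + t * pair_complex b' w1 + s * pair_complex b' w2) < r"
    if "cmod t < \<eta>" "cmod s < \<eta>" "b' \<in> J - {a, b}" for s t b'
    using \<delta>(2)[of u s t b'] \<delta>(1) \<eta>(2) that by simp
  have PJ: "u + t *s w1 + s *s w2 \<in> punctured B J r"
    if "t \<noteq> 0" "s \<noteq> 0" "cmod t < \<eta>" "cmod s < \<eta>" for s t
  proof -
    have "u + t *s w1 + s *s w2 \<in> coord_subspace B J"
      by (intro coord_subspace_add coord_subspace_scale uJ w1 w2)
    moreover have "pair_complex b' (u + t *s w1 + s *s w2) \<noteq> 0 \<and>
        cmod (pair_complex b' (u + t *s w1 + s *s w2)) < r" if "b' \<in> J" for b'
      using oth[of t s b'] gen[of t s] \<open>b' \<in> J\<close> that uab w1 w2 that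
        \<open>t \<noteq> 0\<close> \<open>s \<noteq> 0\<close> \<open>cmod t < \<eta>\<close> \<open>cmod s < \<eta>\<close>
      by (cases "b' = a"; cases "b' = b") (auto simp: J(4))
    ultimately show ?thesis by (simp add: punctured_def)
  qed
  have Pa: "u + s *s w2 \<in> punctured B (J - {a}) r" if "s \<noteq> 0" "cmod s < \<eta>" for s
  proof -
    have "u + s *s w2 \<in> coord_subspace B (J - {a})"
      by (rule coord_subspace_Diff) (auto intro!: coord_subspace_add coord_subspace_scale uJ w2 simp: uab w2)
    moreover have "pair_complex b' (u + s *s w2) \<noteq> 0 \<and> cmod (pair_complex b' (u + s *s w2)) < r"
      if "b' \<in> J - {a}" for b'
      using oth[of 0 s b'] gen[of 0 s] that uab w2 \<open>s \<noteq> 0\<close> \<open>cmod s < \<eta>\<close> \<eta>(1)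
      by (cases "b' = b") auto
    ultimately show ?thesis by (simp add: punctured_def)
  qed
  have Pb: "u + t *s w1 \<in> punctured B (J - {b}) r" if "t \<noteq> 0" "cmod t < \<eta>" for t
  proof -
    have "u + t *s w1 \<in> coord_subspace B (J - {b})"
      by (rule coord_subspace_Diff) (auto intro!: coord_subspace_add coord_subspace_scale uJ w1 simp: uab w1)
    moreover have "pair_complex b' (u + t *s w1) \<noteq> 0 \<and> cmod (pair_complex b' (u + t *s w1)) < r"
      if "b' \<in> J - {b}" for b'
      using oth[of t 0 b'] gen[of t 0] that uab w1 \<open>t \<noteq> 0\<close> \<open>cmod t < \<eta>\<close> \<eta>(1)
      by (cases "b' = a") auto
    ultimately show ?thesis by (simp add: punctured_def)
  qed
  \<comment> \<open>The inner radius \<open>\<tau>\<close> is so small that \<open>cmod (t c) < \<sigma>\<close> even for \<open>cmod t < 2 \<tau>\<close>; then \<open>s + t c\<close> stays in the punctured disc of radius \<open>\<eta>\<close> for \<open>cmod s = \<sigma>\<close>.\<close>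
  define \<sigma> where "\<sigma> = \<eta> / 2"
  define \<tau> where "\<tau> = \<eta> / (8 * (1 + cmod c))"
  have \<sigma>: "0 < \<sigma>" "\<sigma> < \<eta>" using \<eta>(1) by (auto simp: \<sigma>_def)
  have \<tau>: "0 < \<tau>" "2 * \<tau> < \<eta>" "2 * \<tau> * cmod c < \<eta> / 2"
  proof -
    have p: "1 + cmod c > 0" using norm_ge_zero[of c] by linarith
    show "0 < \<tau>" using \<eta>(1) p by (simp add: \<tau>_def)
    have "\<tau> * (1 + cmod c) = \<eta> / 8" using p by (simp add: \<tau>_def field_simps)
    then have "\<tau> + \<tau> * cmod c = \<eta> / 8" by (simp add: algebra_simps)
    moreover have "0 \<le> \<tau> * cmod c" using \<open>0 < \<tau>\<close> by simp
    ultimately show "2 * \<tau> < \<eta>" "2 * \<tau> * cmod c < \<eta> / 2" using \<open>0 < \<tau>\<close> \<eta>(1) by linarith+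
  qed
  have \<tau>': "\<tau> < \<eta>" using \<tau> by linarith
  have shift: "s + t * c \<noteq> 0" "cmod (s + t * c) < \<eta>" if "cmod s = \<sigma>" "cmod t < 2 * \<tau>" for s t
  proof -
    have "cmod (t * c) \<le> 2 * \<tau> * cmod c"
      using that by (simp add: norm_mult mult_right_mono)
    then have tc: "cmod (t * c) < \<sigma>" using \<tau>(3) by (simp add: \<sigma>_def)
    then show "cmod (s + t * c) < \<eta>"
      using norm_triangle_ineq[of s "t * c"] that by (simp add: \<sigma>_def)
    show "s + t * c \<noteq> 0"
      using tc that(1) by (metis add_eq_0_iff norm_minus_cancel order_less_irrefl)
  qed
  let ?w = "w1 + c *s w2" and ?gs = "circlepath 0 \<sigma>" and ?gt = "circlepath 0 \<tau>"
  let ?K = "\<lambda>s t. F (u + t *s w1 + (s + t * c) *s w2)"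
  have wJ: "?w \<in> coord_subspace B J" "pair_complex a ?w \<noteq> 0"
    using w1 w2 by (auto intro!: coord_subspace_add coord_subspace_scale)
  have G: "holomorphic_punctured B (J - {a}) r (dir_residue ?w F)"
    by (rule holomorphic_punctured_dir_residue[OF F]) (use J r wJ in auto)
  have H: "holomorphic_punctured B (J - {b}) r (dir_residue w2 F)"
    by (rule holomorphic_punctured_dir_residue[OF F]) (use J r w2 in auto)
  have line: "u + s *s w2 + t *s ?w = u + t *s w1 + (s + t * c) *s w2" for s t
    by (simp add: vec_eq_iff algebra_simps)
  have contK: "continuous_on (path_image ?gs \<times> path_image ?gt) (\<lambda>(s, t). ?K s t)"
  proof -
    have "continuous_on (path_image ?gs \<times> path_image ?gt)
        (\<lambda>p. F (u + snd p *s w1 + (fst p + snd p * c) *s w2))"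
    proof (rule continuous_on_compose2[of "punctured B J r" F])
      show "continuous_on (punctured B J r) F" using F by (simp add: holomorphic_punctured_def)
      show "(\<lambda>p. u + snd p *s w1 + (fst p + snd p * c) *s w2) ` (path_image ?gs \<times> path_image ?gt)
          \<subseteq> punctured B J r"
      proof safe
        fix s t assume "s \<in> path_image ?gs" "t \<in> path_image ?gt"
        then have "cmod s = \<sigma>" "cmod t = \<tau>" using \<sigma> \<tau> by auto
        then have "u + t *s w1 + (s + t * c) *s w2 \<in> punctured B J r"
          by (intro PJ shift) (use \<tau> in auto)
        then show "u + snd (s, t) *s w1 + (fst (s, t) + snd (s, t) * c) *s w2 \<in> punctured B J r"
          by simp
      qed
    qed (intro continuous_intros)
    then show ?thesis by (simp add: case_prod_unfold)
  qed
  have "dir_residue w2 (dir_residue ?w F) u =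
      contour_integral ?gs (\<lambda>s. dir_residue ?w F (u + s *s w2)) / (2 * pi * \<i>)"
    by (rule dir_residue_contour[OF G _ _ Pa])
       (use \<sigma> w2 in \<open>auto intro!: coord_subspace_Diff uJ simp: uab\<close>)
  also have "contour_integral ?gs (\<lambda>s. dir_residue ?w F (u + s *s w2)) =
      contour_integral ?gs (\<lambda>s. contour_integral ?gt (?K s) / (2 * pi * \<i>))"
  proof (rule contour_integral_eq)
    fix s assume "s \<in> path_image ?gs"
    then have s: "cmod s = \<sigma>" using \<sigma> by simp
    have "dir_residue ?w F (u + s *s w2) =
        contour_integral ?gt (\<lambda>t. F (u + s *s w2 + t *s ?w)) / (2 * pi * \<i>)"
    proof (rule dir_residue_contour[OF F _ wJ(1), where \<eta> = "2 * \<tau>"])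
      show "u + s *s w2 \<in> coord_subspace B J"
        by (intro coord_subspace_add coord_subspace_scale uJ w2)
      show "u + s *s w2 + t *s ?w \<in> punctured B J r" if "t \<noteq> 0" "cmod t < 2 * \<tau>" for t
        unfolding line by (rule PJ) (use that \<tau> shift[OF s] in auto)
    qed (use \<tau> in auto)
    then show "dir_residue ?w F (u + s *s w2) = contour_integral ?gt (?K s) / (2 * pi * \<i>)"
      by (simp only: line)
  qed
  also have "\<dots> = contour_integral ?gs (\<lambda>s. contour_integral ?gt (?K s)) / (2 * pi * \<i>)"
    by (intro contour_integral_div contour_integrable_continuous_circlepath
        continuous_on_contour_integral_param[OF contK] vector_derivative_circlepath_continuous) auto
  also have "contour_integral ?gs (\<lambda>s. contour_integral ?gt (?K s)) =
      contour_integral ?gt (\<lambda>t. contour_integral ?gs (\<lambda>s. ?K s t))"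
    by (rule contour_integral_swap[OF contK]) (auto intro: vector_derivative_circlepath_continuous)
  also have "\<dots> = contour_integral ?gt (\<lambda>t. 2 * pi * \<i> * dir_residue w2 F (u + t *s w1))"
  proof (rule contour_integral_eq)
    fix t assume "t \<in> path_image ?gt"
    then have t: "cmod t = \<tau>" "t \<noteq> 0" using \<tau> by auto
    let ?\<phi> = "\<lambda>s. F (u + t *s w1 + s *s w2)"
    have hol: "?\<phi> holomorphic_on ball 0 \<eta> - {0}"
      by (rule holomorphic_punctured_line[OF F _ w2(1)])
         (use t \<tau>' in \<open>auto intro!: coord_subspace_add coord_subspace_scale uJ w1 PJ\<close>)
    have "contour_integral ?gs (\<lambda>s. ?K s t) = contour_integral (circlepath (t * c) \<sigma>) ?\<phi>"
      unfolding contour_integral_integral vector_derivative_circlepath by (simp add: circlepath add_ac)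
    also have "\<dots> = 2 * pi * \<i> * dir_residue w2 F (u + t *s w1)"
      unfolding dir_residue_def
      by (rule contour_integral_eccentric_circle[OF hol])
         (use t \<tau> in \<open>auto simp: \<sigma>_def norm_mult\<close>)
    finally show "contour_integral ?gs (\<lambda>s. ?K s t) = 2 * pi * \<i> * dir_residue w2 F (u + t *s w1)" .
  qed
  also have "\<dots> = 2 * pi * \<i> * contour_integral ?gt (\<lambda>t. dir_residue w2 F (u + t *s w1))"
  proof (rule contour_integral_lmul)
    have "(\<lambda>t. dir_residue w2 F (u + t *s w1)) holomorphic_on ball 0 \<eta> - {0}"
      by (rule holomorphic_punctured_line[OF H])
         (use Pb in \<open>auto intro!: coord_subspace_Diff uJ w1 simp: uab w1(3)\<close>)
    then show "(\<lambda>t. dir_residue w2 F (u + t *s w1)) contour_integrable_on ?gt"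
      by (rule contour_integrable_holomorphic_simple) (use \<tau> in auto)
  qed
  also have "\<dots> / (2 * pi * \<i>) / (2 * pi * \<i>) =
      contour_integral ?gt (\<lambda>t. dir_residue w2 F (u + t *s w1)) / (2 * pi * \<i>)"
    by simp
  also have "\<dots> = dir_residue w1 (dir_residue w2 F) u"
    by (rule dir_residue_contour[OF H _ _ Pb, symmetric])
       (use \<tau> in \<open>auto intro!: coord_subspace_Diff uJ w1 simp: uab w1(3)\<close>)
  finally show ?thesis .
qed

section \<open>Iterated residues and triangular changes of direction\<close>

lemma punctured_line:
  assumes "finite J" "a \<in> J" "a \<in> B" "r > 0" "w \<in> coord_subspace B J" "pair_complex a w \<noteq> 0"
    and u: "u \<in> punctured B (J - {a}) r"
  shows "\<exists>\<rho>>0. \<forall>t. t \<noteq> 0 \<longrightarrow> cmod t < \<rho> \<longrightarrow> u + t *s w \<in> punctured B J r"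
proof -
  have "u \<in> coord_subspace B (J - {a})" using u by (simp add: punctured_def)
  moreover obtain \<delta> \<rho> where \<rho>: "\<delta> > 0" "\<rho> > 0"
    "\<And>u' t. u' \<in> coord_subspace B (J - {a}) \<Longrightarrow> dist u' u < \<delta> \<Longrightarrow> t \<noteq> 0 \<Longrightarrow> cmod t < \<rho> \<Longrightarrow>
       u' + t *s w \<in> punctured B J r"
    by (rule dir_residue_local[OF assms]) metis
  ultimately have "u + t *s w \<in> punctured B J r" if "t \<noteq> 0" "cmod t < \<rho>" for t
    using \<rho>(3)[of u t] that by simp
  then show ?thesis by (intro exI[of _ \<rho>]) (simp add: \<rho>(2))
qed

primrec dir_residues :: "(complex ^ 'v::finite) list \<Rightarrow> (complex ^ 'v \<Rightarrow> complex) \<Rightarrow> complex ^ 'v \<Rightarrow> complex" where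
  "dir_residues [] F = F"
| "dir_residues (w # ws) F = dir_residues ws (dir_residue w F)"

locale dual_frame =
  fixes B :: "(real ^ 'v::finite) set" and e :: "real ^ 'v \<Rightarrow> complex ^ 'v"
  assumes finite_B: "finite B"
    and dual: "a \<in> B \<Longrightarrow> b \<in> B \<Longrightarrow> pair_complex b (e a) = (if a = b then 1 else 0)"
    and separating: "(\<And>a. a \<in> B \<Longrightarrow> pair_complex a u = 0) \<Longrightarrow> u = 0"
begin

lemma frame_in_coord_subspace: "J \<subseteq> B \<Longrightarrow> a \<in> J \<Longrightarrow> e a \<in> coord_subspace B J"
  using dual by (auto simp: coord_subspace_def)

lemma finite_subset_B: "J \<subseteq> B \<Longrightarrow> finite J"
  using finite_B finite_subset by blast

lemma coord_subspace_expand: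
  assumes J: "J \<subseteq> B" and v: "v \<in> coord_subspace B J"
  shows "v = (\<Sum>a\<in>J. pair_complex a v *s e a)"
proof -
  have "v - (\<Sum>a\<in>J. pair_complex a v *s e a) = 0"
  proof (rule separating)
    fix b assume b: "b \<in> B"
    have "pair_complex b (\<Sum>a\<in>J. pair_complex a v *s e a) =
        (\<Sum>a\<in>J. if a = b then pair_complex a v else 0)"
      unfolding pair_complex_sum using J b by (intro sum.cong) (auto simp: dual subset_iff)
    also have "\<dots> = pair_complex b v"
      using finite_subset_B[OF J] v b by (auto simp: coord_subspace_def)
    finally show "pair_complex b (v - (\<Sum>a\<in>J. pair_complex a v *s e a)) = 0" by simp
  qed
  then show ?thesis by (simp add: vec_eq_iff)
qed

lemma dir_residue_cong:
  assumes "finite J" "a \<in> J" "a \<in> B" "r > 0" "w \<in> coord_subspace B J" "pair_complex a w \<noteq> 0"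
    and u: "u \<in> punctured B (J - {a}) r"
    and eq: "\<And>u. u \<in> punctured B J r \<Longrightarrow> F u = G u"
  shows "dir_residue w F u = dir_residue w G u"
proof -
  obtain \<rho> where "\<rho> > 0" "\<And>t. t \<noteq> 0 \<Longrightarrow> cmod t < \<rho> \<Longrightarrow> u + t *s w \<in> punctured B J r"
    using punctured_line[OF assms(1-6) u] by blast
  then show ?thesis
    unfolding dir_residue_def
    by (intro residue_cong) (auto simp: eventually_at dist_norm intro!: exI[of _ \<rho>] eq)
qed

lemma zero_in_punctured_empty: "0 \<in> punctured B {} r"
  by (auto simp: punctured_def coord_subspace_def)

lemma dir_residues_cong:
  assumes "distinct as" "set as \<subseteq> B" "r > 0"
    and "\<And>u. u \<in> punctured B (set as) r \<Longrightarrow> F u = G u"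
  shows "dir_residues (map e as) F 0 = dir_residues (map e as) G 0"
  using assms
proof (induction as arbitrary: F G)
  case Nil
  then show ?case using zero_in_punctured_empty by simp
next
  case (Cons a as)
  have "dir_residue (e a) F u = dir_residue (e a) G u" if "u \<in> punctured B (set as) r" for u
    by (rule dir_residue_cong[of "set (a # as)" a r])
       (use Cons.prems that dual[of a a] in \<open>auto intro!: frame_in_coord_subspace\<close>)
  then show ?case using Cons.prems by (auto intro!: Cons.IH)
qed

lemma dir_residue_commute:
  assumes F: "holomorphic_punctured B J r F" and J: "a \<in> J" "b \<in> J" "a \<noteq> b" "J \<subseteq> B"
    and r: "r > 0" and u: "u \<in> punctured B (J - {a, b}) r"
  shows "dir_residue (e b) (dir_residue (e a) F) u = dir_residue (e a) (dir_residue (e b) F) u"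
proof -
  have "a \<in> B" "b \<in> B" using J by auto
  then have "dir_residue (e b) (dir_residue (e a + 0 *s e b) F) u = dir_residue (e a) (dir_residue (e b) F) u"
    by (intro dir_residue_shear[OF F finite_subset_B[OF J(4)] J(1-4) r])
       (use u J dual in \<open>auto intro!: frame_in_coord_subspace\<close>)
  then show ?thesis by simp
qed

lemma holomorphic_punctured_frame_residue:
  assumes "holomorphic_punctured B J r F" "a \<in> J" "J \<subseteq> B" "r > 0"
  shows "holomorphic_punctured B (J - {a}) r (dir_residue (e a) F)"
  by (rule holomorphic_punctured_dir_residue[OF assms(1)])
     (use assms finite_subset_B dual[of a a] in \<open>auto intro!: frame_in_coord_subspace\<close>)

lemma dir_residues_move_front:
  assumes "distinct as" "set as \<subseteq> B" "r > 0" "holomorphic_punctured B (set as) r F" "a \<in> set as"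
  shows "dir_residues (map e as) F 0 = dir_residues (map e (a # remove1 a as)) F 0"
  using assms
proof (induction as arbitrary: F)
  case (Cons b as)
  show ?case
  proof (cases "a = b")
    case False
    then have a: "a \<in> set as" using Cons.prems by simp
    have b: "set (b # as) - {b} = set as" using Cons.prems by auto
    have hol: "holomorphic_punctured B (set as) r (dir_residue (e b) F)"
      using holomorphic_punctured_frame_residue[of "set (b # as)" r F b] Cons.prems b by auto
    have "dir_residues (map e (b # as)) F 0 = dir_residues (map e (a # remove1 a as)) (dir_residue (e b) F) 0"
      using Cons.IH[OF _ _ _ hol a] Cons.prems by simp
    also have "\<dots> = dir_residues (map e (remove1 a as)) (dir_residue (e a) (dir_residue (e b) F)) 0"
      by simp
    also have "\<dots> = dir_residues (map e (remove1 a as)) (dir_residue (e b) (dir_residue (e a) F)) 0"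
    proof (rule dir_residues_cong)
      fix u assume "u \<in> punctured B (set (remove1 a as)) r"
      moreover have "set (remove1 a as) = set (b # as) - {b, a}" using Cons.prems by auto
      ultimately show "dir_residue (e a) (dir_residue (e b) F) u = dir_residue (e b) (dir_residue (e a) F) u"
        by (intro dir_residue_commute[OF Cons.prems(4)]) (use Cons.prems False a in auto)
    qed (use Cons.prems in \<open>auto dest: notin_set_remove1 simp: distinct_remove1\<close>)
    finally show ?thesis using False by simp
  qed simp
qed simp

lemma dir_residues_perm:
  assumes "distinct as" "distinct bs" "set as = set bs" "set as \<subseteq> B" "r > 0"
    and "holomorphic_punctured B (set as) r F"
  shows "dir_residues (map e as) F 0 = dir_residues (map e bs) F 0"
  using assms
proof (induction as arbitrary: bs F)
  case (Cons a as)
  have a: "set (a # as) - {a} = set as" using Cons.prems by auto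
  have "dir_residues (map e as) (dir_residue (e a) F) 0 =
      dir_residues (map e (remove1 a bs)) (dir_residue (e a) F) 0"
    using Cons.prems holomorphic_punctured_frame_residue[of "set (a # as)" r F a] a
    by (intro Cons.IH) (auto simp: distinct_remove1)
  also have "\<dots> = dir_residues (map e (a # remove1 a bs)) F 0" by simp
  also have "\<dots> = dir_residues (map e bs) F 0"
    using Cons.prems by (intro dir_residues_move_front[symmetric, of _ r]) auto
  finally show ?case by simp
qed simp

lemma dir_residue_scale:
  assumes F: "holomorphic_punctured B J r F" and J: "finite J" "a \<in> J" "a \<in> B" and r: "r > 0"
    and w: "w \<in> coord_subspace B J" "pair_complex a w \<noteq> 0" and c: "c \<noteq> 0"
    and u: "u \<in> punctured B (J - {a}) r"
  shows "dir_residue (c *s w) F u = dir_residue w F u / c"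
proof -
  obtain \<rho> where \<rho>: "\<rho> > 0" "\<And>t. t \<noteq> 0 \<Longrightarrow> cmod t < \<rho> \<Longrightarrow> u + t *s w \<in> punctured B J r"
    using punctured_line[OF J r w u] by blast
  have uJ: "u \<in> coord_subspace B J"
    using u by (intro coord_subspace_mono[of u B "J - {a}" J]) (auto simp: punctured_def)
  have "(\<lambda>t. F (u + t *s w)) holomorphic_on ball 0 \<rho> - {0}"
    by (rule holomorphic_punctured_line[OF F uJ w(1)]) (use \<rho> in auto)
  from residue_scale[OF this \<rho>(1) c] show ?thesis
    by (simp add: dir_residue_def mult.commute)
qed

text \<open>
  The components of the first direction along the later ones have no effect on the iterated
  residue. They are removed one at a time: bring the residue along \<open>e b\<close> next to the first one, which
  is possible because residues commute, and apply the shear lemma, whose right side does not depend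
  on the component \<open>c b\<close>.
\<close>

lemma dir_residue_cleared_shears:
  assumes F: "holomorphic_punctured B (set (a # as)) r F" and as: "distinct (a # as)" "set (a # as) \<subseteq> B"
    and r: "r > 0" and c: "c a \<noteq> 0" and X: "X \<subseteq> set as"
  shows "dir_residues (map e as) (dir_residue (c a *s e a + (\<Sum>b\<in>X. c b *s e b)) F) 0 =
      dir_residues (map e as) (dir_residue (c a *s e a) F) 0"
proof -
  let ?J = "set (a # as)"
  have "finite X" using X finite_subset by blast
  then show ?thesis using X
  proof (induction X)
    case (insert b X)
    define w where "w = c a *s e a + (\<Sum>b\<in>X. c b *s e b)"
    have abB: "a \<in> B" "b \<in> B" "X \<subseteq> B" "a \<notin> X" "a \<noteq> b" using as insert by auto
    have Ja: "?J - {a} = set as" using as by auto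
    have sumX: "pair_complex d (\<Sum>b\<in>X. c b *s e b) = 0" if "d \<in> B" "d \<notin> X" for d
      unfolding pair_complex_sum using that abB by (intro sum.neutral) (auto simp: dual subset_iff)
    have sumS: "(\<Sum>b\<in>X. c b *s e b) \<in> coord_subspace B ?J"
      using \<open>finite X\<close> insert.prems as
      by (auto simp: coord_subspace_def intro!: sumX)
    have w: "w \<in> coord_subspace B ?J" "pair_complex a w \<noteq> 0" "pair_complex b w = 0"
      using abB c insert.hyps sumX[of a] sumX[of b] dual[of a a] dual[of a b]
      by (auto simp: w_def simp del: list.set(2) intro: list.set_intros(1)
          intro!: coord_subspace_add coord_subspace_scale sumS frame_in_coord_subspace[OF as(2)])
    have eb: "e b \<in> coord_subspace B ?J" "pair_complex b (e b) \<noteq> 0" "pair_complex a (e b) = 0"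
      using abB insert.prems as dual[of b b] dual[of b a]
      by (auto intro!: frame_in_coord_subspace)
    have b: "b \<in> set as" using insert.prems by auto
    have hol: "holomorphic_punctured B (set as) r (dir_residue v F)"
      if "v \<in> coord_subspace B ?J" "pair_complex a v \<noteq> 0" for v
      using holomorphic_punctured_dir_residue[OF F _ _ abB(1) r that] Ja by simp
    have shear: "dir_residue (e b) (dir_residue (w + k *s e b) F) u = dir_residue w (dir_residue (e b) F) u"
      if "u \<in> punctured B (set (remove1 b as)) r" for u k
    proof -
      have "set (remove1 b as) = ?J - {a, b}" using as b by auto
      then show ?thesis
        using that by (intro dir_residue_shear[OF F _ _ _ abB(5) as(2) r w eb]) (use b in auto)
    qed
    have step: "dir_residues (map e as) (dir_residue (w + k *s e b) F) 0 =
        dir_residues (map e (remove1 b as)) (dir_residue w (dir_residue (e b) F)) 0" for k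
    proof -
      have wk: "w + k *s e b \<in> coord_subspace B ?J" "pair_complex a (w + k *s e b) \<noteq> 0"
        using w eb by (auto intro!: coord_subspace_add coord_subspace_scale)
      have "dir_residues (map e as) (dir_residue (w + k *s e b) F) 0 =
          dir_residues (map e (b # remove1 b as)) (dir_residue (w + k *s e b) F) 0"
        by (rule dir_residues_move_front[OF _ _ r hol[OF wk] b]) (use as in auto)
      also have "\<dots> = dir_residues (map e (remove1 b as)) (dir_residue (e b) (dir_residue (w + k *s e b) F)) 0"
        by simp
      also have "\<dots> = dir_residues (map e (remove1 b as)) (dir_residue w (dir_residue (e b) F)) 0"
        by (rule dir_residues_cong[OF _ _ r shear]) (use as in \<open>auto dest: notin_set_remove1 simp: distinct_remove1\<close>)
      finally show ?thesis .
    qed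
    have "dir_residues (map e as) (dir_residue (c a *s e a + (\<Sum>b\<in>insert b X. c b *s e b)) F) 0 =
        dir_residues (map e as) (dir_residue (w + c b *s e b) F) 0"
      using insert.hyps by (simp add: w_def add_ac)
    also have "\<dots> = dir_residues (map e as) (dir_residue (w + 0 *s e b) F) 0"
      by (simp only: step)
    also have "\<dots> = dir_residues (map e as) (dir_residue (c a *s e a) F) 0"
      using insert.IH insert.prems by (simp add: w_def)
    finally show ?case .
  qed simp
qed

lemma dir_residues_divide:
  assumes "distinct as" "set as \<subseteq> B" "r > 0" "holomorphic_punctured B (set as) r F" "c \<noteq> 0"
  shows "dir_residues (map e as) (\<lambda>u. F u / c) 0 = dir_residues (map e as) F 0 / c"
  using assms
proof (induction as arbitrary: F)
  case (Cons a as)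
  have a: "set (a # as) - {a} = set as" using Cons.prems by auto
  have "dir_residues (map e as) (dir_residue (e a) (\<lambda>u. F u / c)) 0 =
      dir_residues (map e as) (\<lambda>u. dir_residue (e a) F u / c) 0"
  proof (rule dir_residues_cong)
    fix u assume u: "u \<in> punctured B (set as) r"
    have w: "e a \<in> coord_subspace B (set (a # as))" "pair_complex a (e a) \<noteq> 0"
      using Cons.prems dual[of a a] by (auto intro!: frame_in_coord_subspace)
    have u': "u \<in> punctured B (set (a # as) - {a}) r" using u by (simp only: a)
    have J: "finite (set (a # as))" "a \<in> set (a # as)" "a \<in> B" using Cons.prems(2) by auto
    obtain \<rho> where \<rho>: "\<rho> > 0" "\<And>t. t \<noteq> 0 \<Longrightarrow> cmod t < \<rho> \<Longrightarrow> u + t *s e a \<in> punctured B (set (a # as)) r"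
      using punctured_line[OF J Cons.prems(3) w u'] by blast
    have uJ: "u \<in> coord_subspace B (set (a # as))"
      using u coord_subspace_mono[of u B "set as" "set (a # as)"] by (auto simp: punctured_def)
    have "(\<lambda>t. F (u + t *s e a)) holomorphic_on ball 0 \<rho> - {0}"
      by (rule holomorphic_punctured_line[OF Cons.prems(4) uJ w(1)]) (use \<rho> in auto)
    then show "dir_residue (e a) (\<lambda>u. F u / c) u = dir_residue (e a) F u / c"
      using residue_div[of "ball 0 \<rho>" 0 "\<lambda>t. F (u + t *s e a)" c] \<rho>(1) by (simp add: dir_residue_def)
  qed (use Cons.prems in auto)
  also have "\<dots> = dir_residues (map e as) (dir_residue (e a) F) 0 / c"
    using Cons.prems holomorphic_punctured_frame_residue[of "set (a # as)" r F a] a by (intro Cons.IH) auto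
  finally show ?case by simp
qed simp

text \<open>
  Each direction \<open>ws ! i\<close> is a multiple of the frame vector of \<open>as ! i\<close> plus a combination of the
  later ones; only the diagonal entries count, and each of them divides the residue.
\<close>

lemma dir_residues_triangular:
  assumes "distinct as" "set as \<subseteq> B" "r > 0" "holomorphic_punctured B (set as) r F"
    and "length ws = length as"
    and "\<And>i. i < length as \<Longrightarrow> ws ! i \<in> coord_subspace B (set (drop i as))"
    and "\<And>i. i < length as \<Longrightarrow> pair_complex (as ! i) (ws ! i) \<noteq> 0"
  shows "dir_residues ws F 0 =
      dir_residues (map e as) F 0 / (\<Prod>i<length as. pair_complex (as ! i) (ws ! i))"
  using assms
proof (induction as arbitrary: ws F)
  case (Cons a as)
  then obtain w ws' where ws: "ws = w # ws'" by (cases ws) auto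
  let ?J = "set (a # as)"
  have a: "?J - {a} = set as" "a \<in> B" using Cons.prems by auto
  have w: "w \<in> coord_subspace B ?J" "pair_complex a w \<noteq> 0"
    using Cons.prems(6)[of 0] Cons.prems(7)[of 0] ws by auto
  let ?c = "\<lambda>b. pair_complex b w"
  have hol: "holomorphic_punctured B (set as) r (dir_residue w F)"
    using holomorphic_punctured_dir_residue[OF Cons.prems(4) _ _ a(2) Cons.prems(3) w] a by simp
  have "dir_residues ws F 0 = dir_residues ws' (dir_residue w F) 0" by (simp add: ws)
  also have "\<dots> = dir_residues (map e as) (dir_residue w F) 0 / (\<Prod>i<length as. pair_complex (as ! i) (ws' ! i))"
    using Cons.prems(1-3,5) Cons.prems(6)[of "Suc _"] Cons.prems(7)[of "Suc _"] hol
    by (intro Cons.IH) (auto simp: ws)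
  also have "dir_residues (map e as) (dir_residue w F) 0 =
      dir_residues (map e as) (dir_residue (?c a *s e a) F) 0"
  proof -
    have "w = ?c a *s e a + (\<Sum>b\<in>set as. ?c b *s e b)"
      using coord_subspace_expand[OF Cons.prems(2) w(1)] Cons.prems(1) by simp
    then show ?thesis
      using dir_residue_cleared_shears[OF Cons.prems(4) Cons.prems(1-3), of ?c "set as"] w by simp
  qed
  also have "\<dots> = dir_residues (map e as) (\<lambda>u. dir_residue (e a) F u / ?c a) 0"
    using Cons.prems w a dual[of a a]
    by (intro dir_residues_cong[of _ r] dir_residue_scale[OF Cons.prems(4)])
       (auto intro!: frame_in_coord_subspace)
  also have "\<dots> = dir_residues (map e as) (dir_residue (e a) F) 0 / ?c a"
    using Cons.prems w holomorphic_punctured_frame_residue[of ?J r F a] a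
    by (intro dir_residues_divide[of _ r]) auto
  also have "dir_residues (map e as) (dir_residue (e a) F) 0 / ?c a / (\<Prod>i<length as. pair_complex (as ! i) (ws' ! i)) =
      dir_residues (map e (a # as)) F 0 / (\<Prod>i<length (a # as). pair_complex ((a # as) ! i) (ws ! i))"
    by (simp add: ws prod.lessThan_Suc_shift del: prod.lessThan_Suc)
  finally show ?case .
qed simp

end

section \<open>Iterated residues in the coordinates of a basis\<close>

lemma pair_real_alt: "pair_real \<xi> u = \<xi> \<bullet> u"
  by (simp add: pair_real_def inner_vec_def)

lemma pair_complex_linear_left:
  "pair_complex (\<xi> + \<eta>) u = pair_complex \<xi> u + pair_complex \<eta> u"
  "pair_complex (c *\<^sub>R \<xi>) u = of_real c * pair_complex \<xi> u"
  "pair_complex 0 u = 0"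
  by (simp_all add: pair_complex_def algebra_simps sum.distrib sum_distrib_left)

lemma pair_complex_axis [simp]: "pair_complex (axis v 1) u = u $ v"
proof -
  have "pair_complex (axis v 1) u = (\<Sum>w\<in>UNIV. if w = v then u $ w else 0)"
    unfolding pair_complex_def by (intro sum.cong) (auto simp: axis_def)
  then show ?thesis by simp
qed

lemma pair_complex_span_zero:
  assumes "\<xi> \<in> span S" "\<And>\<eta>. \<eta> \<in> S \<Longrightarrow> pair_complex \<eta> u = 0"
  shows "pair_complex \<xi> u = 0"
proof -
  have "subspace {\<xi>. pair_complex \<xi> u = 0}"
    by (auto simp: subspace_def pair_complex_linear_left)
  then show ?thesis using span_minimal[of S "{\<xi>. pair_complex \<xi> u = 0}"] assms by auto
qed

lemma subspace_dual_a: "subspace (dual_a v0)"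
  by (auto simp: dual_a_def subspace_def)

lemma dim_dual_a: "dim (dual_a (v0 :: 'v::finite)) = CARD('v) - 1"
proof -
  have "dual_a v0 = {x. axis v0 1 \<bullet> x = 0}"
    by (auto simp: dual_a_def inner_axis' )
  then show ?thesis using dim_hyperplane[of "axis v0 1 :: real ^ 'v"] by (simp add: axis_eq_0_iff)
qed

lemma is_basis_facts:
  assumes "is_basis v0 (A :: (real ^ 'v::finite) set)"
  shows "independent A" "finite A" "card A = CARD('v) - 1" "A \<subseteq> dual_a v0" "span A = dual_a v0"
proof -
  show i: "independent A" and s: "span A = dual_a v0" using assms by (auto simp: is_basis_def)
  show "finite A" using i by (rule independent_imp_finite)
  show "card A = CARD('v) - 1" using dim_span_eq_card_independent[OF i] s dim_dual_a[of v0] by simp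
  show "A \<subseteq> dual_a v0" using s span_superset by blast
qed

lemma is_basis_list_length: "is_basis_list v0 (\<gamma> :: (real ^ 'v::finite) list) \<Longrightarrow> length \<gamma> = CARD('v) - 1"
  using is_basis_facts(3)[of v0 "set \<gamma>"] distinct_card[of \<gamma>] by (auto simp: is_basis_list_def)

text \<open>
  The vector on which a covector takes its \<open>a\<close>-coefficient with respect to \<open>A\<close>, as
  \<open>pair_real_dual_vector\<close> shows.
\<close>

definition dual_vector :: "'v::finite \<Rightarrow> (real ^ 'v) set \<Rightarrow> real ^ 'v \<Rightarrow> real ^ 'v" where
  "dual_vector v0 A a = (\<chi> v. if v = v0 then 0 else representation A (axis v 1) a)"

definition complexify :: "real ^ 'v::finite \<Rightarrow> complex ^ 'v" where
  "complexify w = (\<chi> v. of_real (w $ v))"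

lemma pair_complex_complexify: "pair_complex \<xi> (complexify w) = of_real (pair_real \<xi> w)"
  by (simp add: pair_complex_def pair_real_def complexify_def)

lemma dual_vector_in_real_a: "dual_vector v0 A a \<in> real_a v0"
  by (simp add: dual_vector_def real_a_def)

lemma pair_real_dual_vector:
  assumes A: "is_basis v0 A" and \<xi>: "\<xi> \<in> dual_a v0"
  shows "pair_real \<xi> (dual_vector v0 A a) = representation A \<xi> a"
proof -
  note A' = is_basis_facts[OF A]
  have ax: "axis v 1 \<in> span A" if "v \<noteq> v0" for v :: 'a
    using that A' by (simp add: dual_a_def axis_def)
  have "\<xi> = (\<Sum>v\<in>UNIV. \<xi> $ v *\<^sub>R axis v 1)"
    by (simp add: basis_expansion flip: scalar_mult_eq_scaleR)
  also have "\<dots> = (\<Sum>v\<in>UNIV - {v0}. \<xi> $ v *\<^sub>R axis v 1)"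
    using \<xi> by (intro sum.mono_neutral_right) (auto simp: dual_a_def)
  finally have "representation A \<xi> a = representation A (\<Sum>v\<in>UNIV - {v0}. \<xi> $ v *\<^sub>R axis v 1) a"
    by simp
  also have "\<dots> = (\<Sum>v\<in>UNIV - {v0}. \<xi> $ v * representation A (axis v 1) a)"
    using ax by (subst representation_sum[OF A'(1)])
      (auto simp: representation_scale[OF A'(1)] span_scale intro!: sum.cong)
  also have "\<dots> = (\<Sum>v\<in>UNIV. \<xi> $ v * dual_vector v0 A a $ v)"
    by (intro sum.mono_neutral_cong_left) (auto simp: dual_vector_def)
  finally show ?thesis by (simp add: pair_real_def)
qed

lemma pair_real_dual_vector_basis:
  assumes A: "is_basis v0 A" and "b \<in> A"
  shows "pair_real b (dual_vector v0 A a) = (if b = a then 1 else 0)"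
  using assms pair_real_dual_vector[OF A, of b a] is_basis_facts[OF A]
  by (auto simp: representation_basis)

lemma separating_complex_a:
  assumes A: "is_basis v0 A" and "u \<in> complex_a v0" "\<And>a. a \<in> A \<Longrightarrow> pair_complex a u = 0"
  shows "u = 0"
proof -
  have "u $ v = 0" for v
  proof (cases "v = v0")
    case False
    then have "axis v 1 \<in> span A"
      using is_basis_facts[OF A] by (simp add: dual_a_def axis_def)
    from pair_complex_span_zero[OF this assms(3)] show ?thesis by simp
  qed (use assms(2) in \<open>simp add: complex_a_def\<close>)
  then show ?thesis by (simp add: Finite_Cartesian_Product.vec_eq_iff)
qed

text \<open>
  The evaluation at \<open>v0\<close> joins the basis, so that the covectors separate all points of
  \<open>complex ^ 'v\<close> and \<open>complex_a v0\<close> itself becomes the coordinate subspace of \<open>A\<close>.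
\<close>

definition frame_covectors :: "'v::finite \<Rightarrow> (real ^ 'v) set \<Rightarrow> (real ^ 'v) set" where
  "frame_covectors v0 A = insert (axis v0 1) A"

definition frame_vector :: "'v::finite \<Rightarrow> (real ^ 'v) set \<Rightarrow> real ^ 'v \<Rightarrow> complex ^ 'v" where
  "frame_vector v0 A a = (if a \<in> A then complexify (dual_vector v0 A a) else axis v0 1)"

lemma axis_notin_basis: "is_basis v0 A \<Longrightarrow> axis v0 1 \<notin> A"
  using is_basis_facts(4)[of v0 A] by (auto simp: dual_a_def)

lemma dual_frame_basis:
  assumes A: "is_basis v0 A"
  shows "dual_frame (frame_covectors v0 A) (frame_vector v0 A)"
proof
  note A' = is_basis_facts[OF A] axis_notin_basis[OF A]
  show "finite (frame_covectors v0 A)" using A' by (simp add: frame_covectors_def)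
  have ax: "pair_complex b (axis v0 1) = 0" if "b \<in> A" for b
  proof -
    have "pair_complex b (axis v0 1) = (\<Sum>v\<in>UNIV. if v = v0 then of_real (b $ v) else 0)"
      unfolding pair_complex_def by (intro sum.cong) (auto simp: axis_def)
    then show ?thesis using that A'(4) by (auto simp: dual_a_def)
  qed
  show "pair_complex b (frame_vector v0 A a) = (if a = b then 1 else 0)"
    if "a \<in> frame_covectors v0 A" "b \<in> frame_covectors v0 A" for a b
  proof (cases "b = axis v0 1")
    case True
    then show ?thesis
      using that A'(6) by (auto simp: frame_vector_def complexify_def dual_vector_def frame_covectors_def)
  next
    case False
    then have "b \<in> A" using that by (simp add: frame_covectors_def)
    then show ?thesis
      using that A'(6) ax[of b]
      by (auto simp: frame_vector_def pair_complex_complexify pair_real_dual_vector_basis[OF A] frame_covectors_def)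
  qed
  show "u = 0" if "\<And>a. a \<in> frame_covectors v0 A \<Longrightarrow> pair_complex a u = 0" for u
    by (rule separating_complex_a[OF A])
      (use that[of "axis v0 1"] that in \<open>auto simp: frame_covectors_def complex_a_def\<close>)
qed

lemma complexify_in_complex_a: "w \<in> real_a v0 \<Longrightarrow> complexify w \<in> complex_a v0"
  by (simp add: real_a_def complex_a_def complexify_def)

lemma complex_a_linear: "u \<in> complex_a v0 \<Longrightarrow> v \<in> complex_a v0 \<Longrightarrow> u + v \<in> complex_a v0"
  "u \<in> complex_a v0 \<Longrightarrow> v \<in> complex_a v0 \<Longrightarrow> u - v \<in> complex_a v0"
  "u \<in> complex_a v0 \<Longrightarrow> c *s u \<in> complex_a v0"
  "0 \<in> complex_a v0"
  "(\<And>i. i \<in> I \<Longrightarrow> g i \<in> complex_a v0) \<Longrightarrow> sum g I \<in> complex_a v0"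
  by (auto simp: complex_a_def)

lemma point_of_coords_eq:
  assumes \<gamma>: "is_basis_list v0 \<gamma>"
  shows "point_of_coords v0 \<gamma> zs =
    (\<Sum>i<length \<gamma>. zs ! i *s complexify (dual_vector v0 (set \<gamma>) (\<gamma> ! i)))" (is "_ = ?p")
  unfolding point_of_coords_def
proof (rule the_equality)
  have B: "is_basis v0 (set \<gamma>)" and d: "distinct \<gamma>" using \<gamma> by (auto simp: is_basis_list_def)
  have p: "?p \<in> complex_a v0"
    by (intro complex_a_linear complexify_in_complex_a dual_vector_in_real_a)
  have pair: "pair_complex (\<gamma> ! i) ?p = zs ! i" if i: "i < length \<gamma>" for i
  proof -
    have "pair_complex (\<gamma> ! i) ?p = (\<Sum>j<length \<gamma>. if j = i then zs ! j else 0)"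
      unfolding pair_complex_sum
      by (intro sum.cong) (use i d in \<open>auto simp: pair_complex_complexify
        pair_real_dual_vector_basis[OF B] nth_eq_iff_index_eq\<close>)
    then show ?thesis using i by simp
  qed
  then show "?p \<in> complex_a v0 \<and> (\<forall>i<length \<gamma>. pair_complex (\<gamma> ! i) ?p = zs ! i)" using p by blast
  fix u assume u: "u \<in> complex_a v0 \<and> (\<forall>i<length \<gamma>. pair_complex (\<gamma> ! i) u = zs ! i)"
  have "u - ?p = 0"
    by (rule separating_complex_a[OF B])
      (use u p pair in \<open>auto simp: in_set_conv_nth intro!: complex_a_linear\<close>)
  then show "u = ?p" by simp
qed

text \<open>
  In linear coordinates, fixing the later variables and varying the first means moving along its
  dual vector; so each step of the iterated residue is a residue along a direction.
\<close>

lemma iterated_residue_linear_coords: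
  "iterated_residue (length ws) (\<lambda>zs. F (u + (\<Sum>i<length ws. zs ! i *s ws ! i))) = dir_residues ws F u"
proof (induction ws arbitrary: F)
  case (Cons w ws)
  have "residue (\<lambda>z. F (u + (\<Sum>i<length (w # ws). (z # zs) ! i *s (w # ws) ! i))) 0 =
      dir_residue w F (u + (\<Sum>i<length ws. zs ! i *s ws ! i))" for zs
  proof -
    have "u + (\<Sum>i<length (w # ws). (z # zs) ! i *s (w # ws) ! i) =
        u + (\<Sum>i<length ws. zs ! i *s ws ! i) + z *s w" for z
      by (simp add: sum.lessThan_Suc_shift add_ac del: sum.lessThan_Suc)
    then show ?thesis by (simp only: dir_residue_def)
  qed
  then show ?case by (simp add: Cons.IH del: sum.lessThan_Suc)
qed simp

lemma IR0_eq_dir_residues: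
  assumes \<gamma>: "is_basis_list v0 \<gamma>"
  shows "IR0 v0 \<gamma> f = dir_residues (map (\<lambda>a. complexify (dual_vector v0 (set \<gamma>) a)) \<gamma>) f 0"
proof -
  let ?ws = "map (\<lambda>a. complexify (dual_vector v0 (set \<gamma>) a)) \<gamma>"
  have "in_coords v0 \<gamma> f = (\<lambda>zs. f (0 + (\<Sum>i<length ?ws. zs ! i *s ?ws ! i)))"
    by (simp add: in_coords_def point_of_coords_eq[OF \<gamma>])
  then have "IR0 v0 \<gamma> f = iterated_residue (length ?ws) (\<lambda>zs. f (0 + (\<Sum>i<length ?ws. zs ! i *s ?ws ! i)))"
    using is_basis_list_length[OF \<gamma>] by (simp add: IR0_def)
  then show ?thesis by (simp only: iterated_residue_linear_coords)
qed

lemma IR0_eq_frame_residues: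
  assumes as: "is_basis_list v0 as"
  shows "IR0 v0 as f = dir_residues (map (frame_vector v0 (set as)) as) f 0"
proof -
  have "map (frame_vector v0 (set as)) as = map (\<lambda>a. complexify (dual_vector v0 (set as) a)) as"
    by (simp add: frame_vector_def)
  then show ?thesis by (simp only: IR0_eq_dir_residues[OF as])
qed

lemma IR0_perm:
  assumes "is_basis_list v0 as" "is_basis_list v0 bs" "set as = set bs" "r > 0"
    and "holomorphic_punctured (frame_covectors v0 (set as)) (set as) r f"
  shows "IR0 v0 as f = IR0 v0 bs f"
proof -
  interpret dual_frame "frame_covectors v0 (set as)" "frame_vector v0 (set as)"
    by (rule dual_frame_basis) (use assms in \<open>simp add: is_basis_list_def\<close>)
  have "dir_residues (map (frame_vector v0 (set as)) as) f 0 =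
      dir_residues (map (frame_vector v0 (set as)) bs) f 0"
    by (rule dir_residues_perm[of _ _ r])
      (use assms in \<open>auto simp: is_basis_list_def frame_covectors_def\<close>)
  then show ?thesis using assms IR0_eq_frame_residues by metis
qed

text \<open>
  If \<open>\<gamma>\<close> and \<open>as\<close> span the same flag, a vector dual to \<open>\<gamma> ! i\<close> annihilates \<open>as ! j\<close> for \<open>j < i\<close>;
  hence the dual vectors of \<open>\<gamma>\<close> are triangular with respect to those of \<open>as\<close>. The diagonal entries
  are the numbers \<open>pair_real (as ! i) W\<close> with \<open>W\<close> dual to \<open>\<gamma> ! i\<close>.
\<close>

lemma IR0_triangular:
  fixes as \<gamma> :: "(real ^ 'v::finite) list"
  assumes as: "is_basis_list v0 as" and \<gamma>: "is_basis_list v0 \<gamma>"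
    and span: "\<And>m. m < CARD('v) \<Longrightarrow> span (set (take m \<gamma>)) = span (set (take m as))"
    and r: "r > 0" and f: "holomorphic_punctured (frame_covectors v0 (set as)) (set as) r f"
  shows "\<And>i j. j < i \<Longrightarrow> i < length as \<Longrightarrow> pair_real (as ! j) (dual_vector v0 (set \<gamma>) (\<gamma> ! i)) = 0"
    and "IR0 v0 \<gamma> f =
      IR0 v0 as f / of_real (\<Prod>i<length as. pair_real (as ! i) (dual_vector v0 (set \<gamma>) (\<gamma> ! i)))"
proof -
  let ?B = "frame_covectors v0 (set as)"
  let ?W = "\<lambda>i. dual_vector v0 (set \<gamma>) (\<gamma> ! i)"
  have bas: "is_basis v0 (set as)" "distinct as" and bg: "is_basis v0 (set \<gamma>)" "distinct \<gamma>"
    using as \<gamma> by (auto simp: is_basis_list_def)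
  have len: "length as = CARD('v) - 1" "length \<gamma> = CARD('v) - 1"
    using as \<gamma> is_basis_list_length by blast+
  interpret dual_frame ?B "frame_vector v0 (set as)" by (rule dual_frame_basis[OF bas(1)])
  have gW: "pair_complex (\<gamma> ! j) (complexify (?W i)) = (if j = i then 1 else 0)"
    if "i < length \<gamma>" "j < length \<gamma>" for i j
    using that bg by (auto simp: pair_complex_complexify pair_real_dual_vector_basis nth_eq_iff_index_eq)
  have low: "pair_complex \<xi> (complexify (?W i)) = 0"
    if i: "i < length as" and \<xi>: "\<xi> \<in> span (set (take i as))" for i \<xi>
  proof (rule pair_complex_span_zero)
    show "\<xi> \<in> span (set (take i \<gamma>))" using \<xi> span[of i] i len by simp
    fix \<eta> assume "\<eta> \<in> set (take i \<gamma>)"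
    then obtain j where "j < i" "j < length \<gamma>" "\<eta> = \<gamma> ! j" by (auto simp: in_set_conv_nth)
    then show "pair_complex \<eta> (complexify (?W i)) = 0" using gW[of i j] i len by simp
  qed
  have low': "pair_complex (as ! j) (complexify (?W i)) = 0" if "j < i" "i < length as" for i j
    by (rule low[OF that(2)], rule span_base) (use that nth_mem[of j "take i as"] in auto)
  then show "pair_real (as ! j) (?W i) = 0" if "j < i" "i < length as" for i j
    using that by (simp add: pair_complex_complexify)
  have diag: "pair_complex (as ! i) (complexify (?W i)) \<noteq> 0" if i: "i < length as" for i
  proof
    assume z: "pair_complex (as ! i) (complexify (?W i)) = 0"
    have "\<gamma> ! i \<in> span (set (take (Suc i) \<gamma>))"
      using i len by (intro span_base) (auto simp: take_Suc_conv_app_nth)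
    then have "\<gamma> ! i \<in> span (set (take (Suc i) as))" using span[of "Suc i"] i len by simp
    then have "pair_complex (\<gamma> ! i) (complexify (?W i)) = 0"
    proof (rule pair_complex_span_zero)
      fix \<eta> assume "\<eta> \<in> set (take (Suc i) as)"
      then consider "\<eta> = as ! i" | "\<eta> \<in> set (take i as)" using i by (auto simp: take_Suc_conv_app_nth)
      then show "pair_complex \<eta> (complexify (?W i)) = 0"
        by cases (use z low[OF i] span_base in auto)
    qed
    then show False using gW[of i i] i len by simp
  qed
  let ?ws = "map (\<lambda>a. complexify (dual_vector v0 (set \<gamma>) a)) \<gamma>"
  have "dir_residues ?ws f 0 = dir_residues (map (frame_vector v0 (set as)) as) f 0 /
      (\<Prod>i<length as. pair_complex (as ! i) (?ws ! i))"
  proof (rule dir_residues_triangular[OF bas(2) _ r f])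
    fix i assume i: "i < length as"
    then have nth: "?ws ! i = complexify (?W i)" using len by simp
    show "pair_complex (as ! i) (?ws ! i) \<noteq> 0" using diag[OF i] nth by simp
    show "?ws ! i \<in> coord_subspace ?B (set (drop i as))"
      unfolding coord_subspace_def
    proof safe
      fix b assume b: "b \<in> ?B" "b \<notin> set (drop i as)"
      have "set as = set (take i as) \<union> set (drop i as)" by (metis append_take_drop_id set_append)
      then consider "b = axis v0 1" | "b \<in> set (take i as)" using b by (auto simp: frame_covectors_def)
      then show "pair_complex b (?ws ! i) = 0"
      proof cases
        case 1
        then show ?thesis using nth by (simp add: complexify_def dual_vector_def)
      next
        case 2
        then show ?thesis using nth low[OF i] span_base by auto
      qed
    qed
  qed (use len in \<open>auto simp: frame_covectors_def\<close>)
  also have "(\<Prod>i<length as. pair_complex (as ! i) (?ws ! i)) =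
      of_real (\<Prod>i<length as. pair_real (as ! i) (?W i))"
    using len by (simp add: pair_complex_complexify)
  finally show "IR0 v0 \<gamma> f = IR0 v0 as f / of_real (\<Prod>i<length as. pair_real (as ! i) (?W i))"
    by (simp add: IR0_eq_dir_residues[OF \<gamma>] IR0_eq_frame_residues[OF as])
qed

section \<open>Determinants and orientation signs\<close>

lemma wedge_eq_det:
  "wedge \<gamma> us = Determinant.det (mat (length \<gamma>) (length \<gamma>) (\<lambda>(i, j). pair_real (\<gamma> ! i) (us ! j)))"
  by (subst det_def'[of _ "length \<gamma>"])
     (auto simp: wedge_def lessThan_atLeast0 permutes_in_image intro!: sum.cong prod.cong)

lemma wedge_triangular:
  assumes "\<And>i j. j < i \<Longrightarrow> i < length \<gamma> \<Longrightarrow> pair_real (\<gamma> ! j) (us ! i) = 0"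
  shows "wedge \<gamma> us = (\<Prod>i<length \<gamma>. pair_real (\<gamma> ! i) (us ! i))"
proof -
  let ?n = "length \<gamma>"
  let ?M = "mat ?n ?n (\<lambda>(i, j). pair_real (\<gamma> ! i) (us ! j))"
  have "Determinant.det ?M = prod_list (diag_mat ?M)"
    by (rule det_lower_triangular[of ?n]) (use assms in auto)
  also have "\<dots> = (\<Prod>i<?n. pair_real (\<gamma> ! i) (us ! i))"
    by (simp add: prod_list_diag_prod lessThan_atLeast0)
  finally show ?thesis by (simp add: wedge_eq_det)
qed

lemma wedge_perm:
  assumes "distinct fs" "distinct as" "set fs = set as"
  shows "\<exists>s\<in>{1, -1}. \<forall>us. wedge fs us = s * wedge as us"
proof -
  have "mset fs = mset as" using assms by (simp add: set_eq_iff_mset_eq_distinct)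
  then obtain p where p: "p permutes {..<length as}" "permute_list p as = fs"
    by (rule mset_eq_permutation)
  let ?n = "length as"
  have len: "length fs = ?n" using p by auto
  have nth: "fs ! i = as ! p i" if "i < ?n" for i
    using permute_list_nth[OF p(1) that] p(2) by simp
  have "wedge fs us = of_int (sign p) * wedge as us" for us
  proof -
    let ?M = "mat ?n ?n (\<lambda>(i, j). pair_real (as ! i) (us ! j))"
    have "mat ?n ?n (\<lambda>(i, j). pair_real (fs ! i) (us ! j)) = mat ?n ?n (\<lambda>(i, j). ?M $$ (p i, j))"
      using p(1) nth by (intro eq_matI) (auto simp: permutes_in_image[of p "{..<?n}", simplified])
    then show ?thesis
      using det_permute_rows[of ?M ?n p] p(1) by (simp add: wedge_eq_det len lessThan_atLeast0)
  qed
  moreover have "of_int (sign p) \<in> {1, -1 :: real}" by (auto simp: sign_def)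
  ultimately show ?thesis by blast
qed

text \<open>
  The partial sums arise from \<open>as\<close> by a unipotent lower triangular matrix.
\<close>

lemma wedge_partial_sums:
  "wedge (map (\<lambda>j. \<Sum>i<j. as ! i) [1..<Suc (length as)]) us = wedge as us"
proof -
  let ?n = "length as"
  let ?\<kappa> = "map (\<lambda>j. \<Sum>i<j. as ! i) [1..<Suc ?n]"
  let ?M = "mat ?n ?n (\<lambda>(i, j). pair_real (as ! i) (us ! j))"
  let ?L = "mat ?n ?n (\<lambda>(i, j). if j \<le> i then 1 else 0) :: real mat"
  have "mat ?n ?n (\<lambda>(i, j). pair_real (?\<kappa> ! i) (us ! j)) = ?L * ?M"
  proof (rule eq_matI)
    fix i j assume ij: "i < dim_row (?L * ?M)" "j < dim_col (?L * ?M)"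
    then have i: "i < ?n" and j: "j < ?n" by auto
    have "(?L * ?M) $$ (i, j) = (\<Sum>k\<in>{0..<?n}. (if k \<le> i then 1 else 0) * pair_real (as ! k) (us ! j))"
      using i j by (simp add: scalar_prod_def)
    also have "\<dots> = (\<Sum>k<Suc i. pair_real (as ! k) (us ! j))"
      by (rule sum.mono_neutral_cong_right) (use i in auto)
    also have "\<dots> = pair_real (?\<kappa> ! i) (us ! j)"
      using i by (simp add: pair_real_alt inner_sum_left inner_add_left del: upt_Suc)
    finally show "mat ?n ?n (\<lambda>(i, j). pair_real (?\<kappa> ! i) (us ! j)) $$ (i, j) = (?L * ?M) $$ (i, j)"
      using i j by simp
  qed auto
  moreover have "Determinant.det ?L = 1"
  proof -
    have "Determinant.det ?L = prod_list (diag_mat ?L)"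
      by (rule det_lower_triangular[of ?n]) auto
    then show ?thesis by (simp add: prod_list_diag_prod)
  qed
  ultimately show ?thesis
    by (simp add: wedge_eq_det det_mult[of ?L ?n ?M] del: upt_Suc)
qed

lemma span_take_partial_sums:
  "set as \<subseteq> span ((\<lambda>j. \<Sum>i<j. as ! i) ` {1..<Suc (length as)})" (is "_ \<subseteq> span ?S")
proof
  fix a assume "a \<in> set as"
  then obtain i where i: "i < length as" "a = as ! i" by (auto simp: in_set_conv_nth)
  have mem: "(\<Sum>i<j. as ! i) \<in> span ?S" if "j \<le> length as" for j
    using that by (cases "j = 0") (auto intro: span_base simp: span_zero)
  have "a = (\<Sum>k<Suc i. as ! k) - (\<Sum>k<i. as ! k)" using i by simp
  then show "a \<in> span ?S" using i by (metis mem span_diff Suc_leI less_imp_le)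
qed

text \<open>
  The differences of the partial sums are the basis vectors, so the partial sums span; there are
  only as many of them as the dimension.
\<close>

lemma is_basis_list_partial_sums:
  fixes as :: "(real ^ 'v::finite) list"
  assumes as: "is_basis_list v0 as"
  shows "is_basis_list v0 (map (\<lambda>j. \<Sum>i<j. as ! i) [1..<Suc (length as)])" (is "is_basis_list v0 ?\<kappa>")
proof -
  have B: "is_basis v0 (set as)" using as by (simp add: is_basis_list_def)
  note B' = is_basis_facts[OF B]
  have "set as \<subseteq> span (set ?\<kappa>)"
    using span_take_partial_sums[of as] by (simp del: upt_Suc)
  then have "dual_a v0 \<subseteq> span (set ?\<kappa>)" using B'(5) span_minimal subspace_span by metis
  moreover have "set ?\<kappa> \<subseteq> dual_a v0"
    using B'(4) by (auto intro!: subspace_sum subspace_dual_a)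
  ultimately have span: "span (set ?\<kappa>) = dual_a v0"
    by (simp add: span_minimal subspace_dual_a subset_antisym)
  have n: "length ?\<kappa> = dim (dual_a v0)"
    using is_basis_list_length[OF as] dim_dual_a[of v0] by simp
  have "dim (dual_a v0) \<le> card (set ?\<kappa>)"
    using span dim_le_card'[of "set ?\<kappa>"] by (metis List.finite_set dim_span)
  then have card: "card (set ?\<kappa>) = length ?\<kappa>"
    using card_length[of ?\<kappa>] n by linarith
  then have "distinct ?\<kappa>" by (rule card_distinct)
  moreover have "independent (set ?\<kappa>)"
    by (rule card_le_dim_spanning[of _ "dual_a v0"]) (use span n card \<open>set ?\<kappa> \<subseteq> dual_a v0\<close> in auto)
  ultimately show ?thesis using span by (simp add: is_basis_list_def is_basis_def)
qed

text \<open>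
  Evaluate all the volume forms on the vectors \<open>W\<close> dual to \<open>\<gamma>\<close>. The form of \<open>\<gamma>\<close> has value 1,
  hence so has that of \<open>fs\<close>, which is \<open>s = \<plusminus>1\<close> times that of \<open>as\<close>. The form of \<open>as\<close>, which is also
  that of the partial sums, has as its value the product \<open>p\<close> of the diagonal entries of
  \<open>IR0_triangular\<close>. So \<open>s p = 1\<close>, and the sign \<open>\<nu>\<close> equals \<open>p\<close>.
\<close>

lemma nu_times_IR0:
  fixes as fs \<gamma> :: "(real ^ 'v::finite) list"
  assumes as: "is_basis_list v0 as" and fs: "frame_in v0 (set as) fs"
    and \<gamma>: "adapted_basis v0 fs Fs \<gamma>"
    and Fs: "\<And>m. m < CARD('v) \<Longrightarrow> Fs ! m = span (set (take m as))"
    and \<kappa>: "kappa_list (set as) Fs = map (\<lambda>j. \<Sum>i<j. as ! i) [1..<Suc (length as)]"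
    and r: "r > 0" and f: "holomorphic_punctured (frame_covectors v0 (set as)) (set as) r f"
  shows "of_int (nu v0 fs (set as) Fs) * IR0 v0 \<gamma> f = IR0 v0 as f"
proof -
  have g: "is_basis_list v0 \<gamma>" using \<gamma> by (simp add: adapted_basis_def)
  have wg: "wedge \<gamma> us = wedge fs us" if "us \<in> tuples v0" for us
    using \<gamma> that by (simp add: adapted_basis_def)
  have span: "span (set (take m \<gamma>)) = span (set (take m as))" if "m < CARD('v)" for m
    using \<gamma> Fs that by (simp add: adapted_basis_def)
  have bg: "is_basis v0 (set \<gamma>)" "distinct \<gamma>" and ba: "is_basis v0 (set as)" "distinct as"
    using g as by (auto simp: is_basis_list_def)
  have len: "length as = CARD('v) - 1" "length \<gamma> = CARD('v) - 1"
    using as g is_basis_list_length by blast+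
  \<comment> \<open>The test vectors: the basis of \<open>real_a v0\<close> dual to \<open>\<gamma>\<close>.\<close>
  define W where "W = map (dual_vector v0 (set \<gamma>)) \<gamma>"
  have W: "W \<in> tuples v0" using len dual_vector_in_real_a by (auto simp: W_def tuples_def)
  have Wnth: "W ! i = dual_vector v0 (set \<gamma>) (\<gamma> ! i)" if "i < length as" for i
    using that len by (simp add: W_def)
  define p where "p = (\<Prod>i<length as. pair_real (as ! i) (dual_vector v0 (set \<gamma>) (\<gamma> ! i)))"
  note tri = IR0_triangular[OF as g span r f]
  have wa: "wedge as W = p"
    using tri(1) by (subst wedge_triangular) (auto simp: Wnth p_def)
  have "wedge \<gamma> W = 1"
  proof (subst wedge_triangular)
    show "pair_real (\<gamma> ! j) (W ! i) = 0" if "j < i" "i < length \<gamma>" for i j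
      using that bg len by (auto simp: Wnth pair_real_dual_vector_basis nth_eq_iff_index_eq)
    show "(\<Prod>i<length \<gamma>. pair_real (\<gamma> ! i) (W ! i)) = 1"
      using bg len by (intro prod.neutral) (auto simp: Wnth pair_real_dual_vector_basis)
  qed
  then have wf: "wedge fs W = 1" using wg[OF W] by simp
  have fs': "set fs \<subseteq> set as" "distinct fs" "is_basis v0 (set fs)"
    using fs by (auto simp: frame_in_def is_basis_list_def)
  have "set fs = set as"
    by (rule card_subset_eq) (use fs'(1) is_basis_facts(3)[OF ba(1)] is_basis_facts(3)[OF fs'(3)] in auto)
  then obtain s where s: "s \<in> {1, -1}" "\<And>us. wedge fs us = s * wedge as us"
    using wedge_perm[OF fs'(2) ba(2)] by blast
  have sp: "s * p = 1" using s(2)[of W] wa wf by simp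
  have wk: "wedge (kappa_list (set as) Fs) us = wedge as us" for us
    by (simp only: \<kappa> wedge_partial_sums)
  have kb: "is_basis_list v0 (kappa_list (set as) Fs)"
    using is_basis_list_partial_sums[OF as] by (simp only: \<kappa>)
  have "of_int (nu v0 fs (set as) Fs) = p"
  proof (cases "s = 1")
    case True
    then have "\<exists>c>0. \<forall>us\<in>tuples v0. wedge (kappa_list (set as) Fs) us = c * wedge fs us"
      using wk s(2) by (intro exI[of _ 1]) simp
    then show ?thesis using kb True sp by (simp add: nu_def)
  next
    case False
    then have "p = -1" using s(1) sp by auto
    then have "\<not> (\<exists>c>0. \<forall>us\<in>tuples v0. wedge (kappa_list (set as) Fs) us = c * wedge fs us)"
      using wk W wf wa by force
    then show ?thesis using kb \<open>p = -1\<close> by (simp add: nu_def)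
  qed
  then have "of_int (nu v0 fs (set as) Fs) = (of_real p :: complex)"
    by (metis of_real_of_int_eq)
  moreover have "p \<noteq> 0" using sp by auto
  ultimately show ?thesis using tri(2) by (simp add: p_def)
qed

section \<open>Flags and cones of a basis\<close>

definition ordered_flag :: "(real ^ 'v::finite) list \<Rightarrow> (real ^ 'v) set list" where
  "ordered_flag as = map (\<lambda>m. span (set (take m as))) [0..<CARD('v)]"

lemma ordered_flag_nth:
  "m < CARD('v) \<Longrightarrow> ordered_flag (as :: (real ^ 'v::finite) list) ! m = span (set (take m as))"
  by (simp add: ordered_flag_def)

lemma independent_Int_span:
  assumes "independent A" "S \<subseteq> A"
  shows "A \<inter> span S = S"
proof
  show "A \<inter> span S \<subseteq> S"
  proof
    fix a assume a: "a \<in> A \<inter> span S"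
    show "a \<in> S"
    proof (rule ccontr)
      assume "a \<notin> S"
      then have "S \<subseteq> A - {a}" using assms(2) by auto
      then have "a \<in> span (A - {a})" using a span_mono by blast
      then show False using assms(1) a by (auto simp: dependent_def)
    qed
  qed
qed (use assms span_superset in auto)

lemma ordered_flag_Int:
  fixes as :: "(real ^ 'v::finite) list"
  assumes "is_basis_list v0 as" "m < CARD('v)"
  shows "set as \<inter> ordered_flag as ! m = set (take m as)"
  using independent_Int_span[of "set as" "set (take m as)"] assms set_take_subset[of m as]
  by (simp add: ordered_flag_nth is_basis_list_def is_basis_def)

lemma ordered_flag_in_flags:
  fixes as :: "(real ^ 'v::finite) list"
  assumes as: "is_basis_list v0 as"
  shows "ordered_flag as \<in> flags v0 (set as)"
proof -
  have B: "is_basis v0 (set as)" "distinct as" using as by (auto simp: is_basis_list_def)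
  note B' = is_basis_facts[OF B(1)]
  have n: "length as = CARD('v) - 1" by (rule is_basis_list_length[OF as])
  have dim: "dim (span (set (take m as))) = m" if "m < CARD('v)" for m
  proof -
    have "independent (set (take m as))"
      by (rule independent_mono[OF B'(1) set_take_subset])
    then have "dim (span (set (take m as))) = card (set (take m as))"
      by (rule dim_span_eq_card_independent)
    also have "\<dots> = m" using B(2) n that by (simp add: distinct_card)
    finally show ?thesis .
  qed
  have "ordered_flag as ! (CARD('v) - 1) = dual_a v0"
    using n B'(5) by (simp add: ordered_flag_nth)
  moreover have "ordered_flag as ! m \<subseteq> ordered_flag as ! Suc m" if "m < CARD('v) - 1" for m
    using that by (simp add: ordered_flag_nth span_mono set_take_subset_set_take)
  moreover have "\<exists>C\<subseteq>set as. ordered_flag as ! m = span C" if "m < CARD('v)" for m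
    using that set_take_subset[of m as] by (auto simp: ordered_flag_nth)
  moreover have "ordered_flag as ! 0 = {0}" by (simp add: ordered_flag_nth)
  moreover have "length (ordered_flag as) = CARD('v)" by (simp add: ordered_flag_def)
  moreover have "dim (ordered_flag as ! m) = m" if "m < CARD('v)" for m
    using dim[OF that] that by (simp only: ordered_flag_nth)
  ultimately show ?thesis
    unfolding flags_def mem_Collect_eq by (intro conjI allI impI) simp_all
qed

lemma kappa_ordered_flag:
  fixes as :: "(real ^ 'v::finite) list"
  assumes as: "is_basis_list v0 as" and m: "m < CARD('v)"
  shows "kappa (set as) (ordered_flag as) m = (\<Sum>i<m. as ! i)"
proof -
  have d: "distinct as" using as by (simp add: is_basis_list_def)
  have "m \<le> length as" using m is_basis_list_length[OF as] by simp
  moreover have "set (take m as) = (!) as ` {..<m}"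
    using nth_image[OF \<open>m \<le> length as\<close>] by (simp add: lessThan_atLeast0)
  moreover have "inj_on ((!) as) {..<m}"
    using d \<open>m \<le> length as\<close> by (auto simp: inj_on_def nth_eq_iff_index_eq)
  ultimately show ?thesis
    by (simp add: kappa_def ordered_flag_Int[OF as m] sum.reindex)
qed

lemma kappa_list_ordered_flag:
  fixes as :: "(real ^ 'v::finite) list"
  assumes as: "is_basis_list v0 as"
  shows "kappa_list (set as) (ordered_flag as) = map (\<lambda>j. \<Sum>i<j. as ! i) [1..<Suc (length as)]"
proof -
  have "Suc (length as) = CARD('v)" using is_basis_list_length[OF as] by simp
  then show ?thesis by (simp add: kappa_list_def kappa_ordered_flag[OF as])
qed

lemma sum_by_parts_partial_sums:
  fixes x :: "nat \<Rightarrow> 'a::real_vector"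
  shows "(\<Sum>j=1..m. (r j - r (Suc j)) *\<^sub>R (\<Sum>i<j. x i)) + r (Suc m) *\<^sub>R (\<Sum>i<m. x i) =
    (\<Sum>i<m. r (Suc i) *\<^sub>R x i)"
proof (induction m)
  case (Suc m)
  then show ?case
    by (simp add: scaleR_left_diff_distrib scaleR_add_right flip: Suc.IH)
qed simp

text \<open>
  Summation by parts, with the coefficient after the last one taken to be zero: the coefficient of
  the \<open>j\<close>-th partial sum is the difference of two successive coefficients of \<open>\<zeta>\<close>.
\<close>

lemma ordered_flag_cone:
  fixes as :: "(real ^ 'v::finite) list"
  assumes as: "is_basis_list v0 as" and \<zeta>: "\<zeta> \<in> dual_a v0"
    and pos: "\<And>a. a \<in> set as \<Longrightarrow> 0 < representation (set as) \<zeta> a"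
    and dec: "\<And>i j. i < j \<Longrightarrow> j < length as \<Longrightarrow>
      representation (set as) \<zeta> (as ! j) < representation (set as) \<zeta> (as ! i)"
  shows "\<zeta> \<in> kappa_cone (set as) (ordered_flag as)"
proof -
  let ?n = "length as"
  have B: "is_basis v0 (set as)" "distinct as" using as by (auto simp: is_basis_list_def)
  note B' = is_basis_facts[OF B(1)]
  have n: "CARD('v) - 1 = ?n" using is_basis_list_length[OF as] by simp
  \<comment> \<open>Shifted by one, so that \<open>r j\<close> belongs to \<open>as ! (j - 1)\<close> and \<open>r (Suc ?n) = 0\<close>.\<close>
  define r where "r j = (if j \<le> ?n then representation (set as) \<zeta> (as ! (j - 1)) else 0)" for j
  have "\<zeta> = (\<Sum>a\<in>set as. representation (set as) \<zeta> a *\<^sub>R a)"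
    using \<zeta> B' by (simp add: sum_representation_eq)
  also have "\<dots> = (\<Sum>i<?n. r (Suc i) *\<^sub>R as ! i)"
    using bij_betw_nth[OF B(2), of "{..<?n}" "set as"]
    by (subst sum.reindex_bij_betw[symmetric]) (auto simp: r_def intro!: sum.cong)
  also have "\<dots> = (\<Sum>j=1..?n. (r j - r (Suc j)) *\<^sub>R (\<Sum>i<j. as ! i))"
    using sum_by_parts_partial_sums[of r "\<lambda>i. as ! i" ?n] by (simp add: r_def)
  also have "\<dots> = (\<Sum>j=1..CARD('v) - 1. (r j - r (Suc j)) *\<^sub>R kappa (set as) (ordered_flag as) j)"
    unfolding n using n by (intro sum.cong) (auto simp: kappa_ordered_flag[OF as])
  finally have eq: "\<zeta> = \<dots>" .
  have "0 < r j - r (Suc j)" if "j \<in> {1..CARD('v) - 1}" for j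
    using that pos[of "as ! (j - 1)"] dec[of "j - 1" j] n by (auto simp: r_def)
  then show ?thesis
    unfolding kappa_cone_def mem_Collect_eq
    by (intro exI[of _ "\<lambda>j. r j - r (Suc j)"] conjI ballI eq)
qed

lemma flags_Int:
  fixes A :: "(real ^ 'v::finite) set"
  assumes A: "is_basis v0 A" and Fs: "Fs \<in> flags v0 A" and m: "m < CARD('v)"
  shows "Fs ! m = span (A \<inter> Fs ! m)" "card (A \<inter> Fs ! m) = m"
proof -
  note A' = is_basis_facts[OF A]
  obtain C where C: "C \<subseteq> A" "Fs ! m = span C" and d: "dim (Fs ! m) = m"
    using Fs m unfolding flags_def by blast
  have int: "A \<inter> Fs ! m = C" using independent_Int_span[OF A'(1) C(1)] C(2) by simp
  then show "Fs ! m = span (A \<inter> Fs ! m)" using C by simp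
  show "card (A \<inter> Fs ! m) = m"
    using int d C dim_span_eq_card_independent[of C] independent_mono[OF A'(1) C(1)] by simp
qed

lemma flags_mono:
  fixes A :: "(real ^ 'v::finite) set"
  assumes "Fs \<in> flags v0 A" "i \<le> j" "j < CARD('v)"
  shows "Fs ! i \<subseteq> Fs ! j"
  using assms(2,3)
proof (induction j rule: dec_induct)
  case (step j)
  then have "Fs ! j \<subseteq> Fs ! Suc j" using assms(1) by (auto simp: flags_def)
  then show ?case using step by auto
qed simp

lemma representation_kappa_combination:
  fixes A :: "(real ^ 'v::finite) set"
  assumes A: "is_basis v0 A" and a: "a \<in> A"
  shows "representation A (\<Sum>j=1..CARD('v) - 1. c j *\<^sub>R kappa A Fs j) a =
    (\<Sum>j\<in>{j\<in>{1..CARD('v) - 1}. a \<in> Fs ! j}. c j)"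
proof -
  note A' = is_basis_facts[OF A]
  have k: "kappa A Fs j \<in> span A" for j
    unfolding kappa_def by (intro span_sum) (auto intro: span_base)
  have rk: "representation A (kappa A Fs j) a = (if a \<in> Fs ! j then 1 else 0)" for j
  proof -
    have "representation A (kappa A Fs j) a = (\<Sum>b\<in>A \<inter> Fs ! j. representation A b a)"
      unfolding kappa_def by (subst representation_sum[OF A'(1)]) (auto intro: span_base)
    also have "\<dots> = (\<Sum>b\<in>A \<inter> Fs ! j. if b = a then 1 else 0)"
      by (intro sum.cong) (auto simp: representation_basis[OF A'(1)])
    finally show ?thesis using a A'(2) by simp
  qed
  have "representation A (\<Sum>j=1..CARD('v) - 1. c j *\<^sub>R kappa A Fs j) a =
      (\<Sum>j=1..CARD('v) - 1. c j * (if a \<in> Fs ! j then 1 else 0))"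
    using k by (subst representation_sum[OF A'(1)])
      (auto simp: representation_scale[OF A'(1)] span_scale rk)
  also have "\<dots> = (\<Sum>j\<in>{j\<in>{1..CARD('v) - 1}. a \<in> Fs ! j}. c j)"
    by (subst sum.inter_filter) (auto intro!: sum.cong)
  finally show ?thesis .
qed

text \<open>
  The coefficient of a basis vector is the sum of the \<open>c j\<close> over the members of the flag that
  contain it. All vectors are in the last member, and a vector that enters the flag earlier collects
  more summands.
\<close>

lemma kappa_cone_coefficients:
  fixes A :: "(real ^ 'v::finite) set"
  assumes A: "is_basis v0 A" and Fs: "Fs \<in> flags v0 A" and \<zeta>: "\<zeta> \<in> kappa_cone A Fs"
  shows "a \<in> A \<Longrightarrow> 0 < representation A \<zeta> a"
    and "a \<in> A \<Longrightarrow> b \<in> A \<Longrightarrow> m < CARD('v) \<Longrightarrow> a \<in> Fs ! m \<Longrightarrow> b \<notin> Fs ! m \<Longrightarrow>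
      representation A \<zeta> b < representation A \<zeta> a"
proof -
  note A' = is_basis_facts[OF A]
  obtain c where c: "\<zeta> = (\<Sum>j=1..CARD('v) - 1. c j *\<^sub>R kappa A Fs j)" "\<And>j. j \<in> {1..CARD('v) - 1} \<Longrightarrow> 0 < c j"
    using \<zeta> unfolding kappa_cone_def by blast
  let ?J = "\<lambda>a. {j\<in>{1..CARD('v) - 1}. a \<in> Fs ! j}"
  have rep: "representation A \<zeta> a = sum c (?J a)" if "a \<in> A" for a
    unfolding c(1) by (rule representation_kappa_combination[OF A that])
  show "0 < representation A \<zeta> a" if a: "a \<in> A"
  proof -
    have "card A > 0" using a A'(2) card_gt_0_iff by blast
    moreover have "Fs ! (CARD('v) - 1) = dual_a v0" using Fs by (simp add: flags_def)
    ultimately have "CARD('v) - 1 \<in> ?J a" using A'(3,4) a by auto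
    then show ?thesis
      unfolding rep[OF a] by (intro sum_pos) (use c(2) in auto)
  qed
  assume a: "a \<in> A" and b: "b \<in> A" and m: "m < CARD('v)" and am: "a \<in> Fs ! m" and bm: "b \<notin> Fs ! m"
  have "Fs ! 0 = {0}" using Fs by (simp add: flags_def)
  moreover have "a \<noteq> 0" using a A'(1) dependent_zero by blast
  ultimately have "m \<noteq> 0" using am by (metis singletonD)
  then have "m \<in> ?J a - ?J b" using am bm m by auto
  moreover have "?J b \<subseteq> ?J a"
  proof safe
    fix j assume j: "j \<in> {1..CARD('v) - 1}" "b \<in> Fs ! j"
    then have "j < CARD('v)" by auto
    have "m \<le> j"
    proof (rule ccontr)
      assume "\<not> m \<le> j"
      then show False using flags_mono[OF Fs, of j m] m j bm by auto
    qed
    then show "a \<in> Fs ! j" using flags_mono[OF Fs _ \<open>j < CARD('v)\<close>] am by blast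
  qed
  ultimately show "representation A \<zeta> b < representation A \<zeta> a"
    unfolding rep[OF a] rep[OF b]
    by (intro sum_strict_mono2) (use c(2) in \<open>auto intro: less_imp_le\<close>)
qed

text \<open>
  The \<open>m\<close>-th member of a flag whose cone contains \<open>\<zeta>\<close> contains the \<open>m\<close> basis vectors with the
  largest coefficients.
\<close>

lemma flag_of_cone_unique:
  fixes as :: "(real ^ 'v::finite) list"
  assumes as: "is_basis_list v0 as"
    and dec: "\<And>i j. i < j \<Longrightarrow> j < length as \<Longrightarrow>
      representation (set as) \<zeta> (as ! j) < representation (set as) \<zeta> (as ! i)"
    and Fs: "Fs \<in> flags v0 (set as)" and \<zeta>: "\<zeta> \<in> kappa_cone (set as) Fs"
  shows "Fs = ordered_flag as"
proof (rule nth_equalityI)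
  have B: "is_basis v0 (set as)" "distinct as" using as by (auto simp: is_basis_list_def)
  have n: "length as = CARD('v) - 1" by (rule is_basis_list_length[OF as])
  show len: "length Fs = length (ordered_flag as)"
    using Fs by (simp add: flags_def ordered_flag_def)
  fix m assume "m < length Fs"
  then have m: "m < CARD('v)" using Fs by (simp add: flags_def)
  let ?T = "set (take m as)" and ?F = "set as \<inter> Fs ! m"
  have card: "card ?F = card ?T"
    using flags_Int(2)[OF B(1) Fs m] m n B(2) by (simp add: distinct_card)
  have "?F \<subseteq> ?T"
  proof (rule ccontr)
    assume "\<not> ?F \<subseteq> ?T"
    then obtain a where a: "a \<in> ?F" "a \<notin> ?T" by blast
    have "\<not> ?T \<subseteq> ?F"
      using a card card_subset_eq[of ?F ?T] by auto
    then obtain b where b: "b \<in> ?T" "b \<notin> ?F" by blast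
    have bas: "b \<in> set as" using b(1) set_take_subset by fast
    then have lt: "representation (set as) \<zeta> b < representation (set as) \<zeta> a"
      using kappa_cone_coefficients(2)[OF B(1) Fs \<zeta>, of a b m] a b m by auto
    obtain i where i: "i < m" "i < length as" "b = as ! i" using b(1) by (auto simp: in_set_conv_nth)
    obtain k where k: "k < length as" "a = as ! k" using a(1) by (auto simp: in_set_conv_nth)
    have "m \<le> k"
    proof (rule ccontr)
      assume "\<not> m \<le> k"
      then have "take m as ! k = a" "k < length (take m as)" using k by auto
      then show False using a(2) nth_mem by metis
    qed
    then show False using dec[of i k] i k lt by simp
  qed
  then have "?F = ?T" using card by (intro card_subset_eq) auto
  then show "Fs ! m = ordered_flag as ! m"
    using flags_Int(1)[OF B(1) Fs m] by (simp add: ordered_flag_nth[OF m])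
qed

lemma decreasing_enumeration:
  fixes c :: "'a \<Rightarrow> real"
  assumes "finite A" "inj_on c A"
  obtains as where "distinct as" "set as = A" "\<And>i j. i < j \<Longrightarrow> j < length as \<Longrightarrow> c (as ! j) < c (as ! i)"
proof -
  define xs where "xs = sorted_list_of_set ((\<lambda>a. - c a) ` A)"
  define g where "g = inv_into A (\<lambda>a. - c a)"
  have inj: "inj_on (\<lambda>a. - c a) A" using assms(2) by (auto simp: inj_on_def)
  have xs: "set xs = (\<lambda>a. - c a) ` A" "sorted_wrt (<) xs"
    using assms(1) by (simp_all add: xs_def)
  have gx: "- c (g x) = x" if "x \<in> set xs" for x
    using that xs(1) f_inv_into_f[of x "\<lambda>a. - c a" A] by (simp add: g_def)
  show ?thesis
  proof (rule that[of "map g xs"])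
    show "set (map g xs) = A"
    proof -
      have "g (- c a) = a" if "a \<in> A" for a
        unfolding g_def by (rule inv_into_f_f[OF inj that])
      then show ?thesis by (simp add: xs(1) image_image)
    qed
    show dec: "c (map g xs ! j) < c (map g xs ! i)" if "i < j" "j < length (map g xs)" for i j
    proof -
      have "xs ! i < xs ! j" using xs(2) that by (auto simp: sorted_wrt_iff_nth_less)
      then show ?thesis using that gx[of "xs ! i"] gx[of "xs ! j"] by auto
    qed
    show "distinct (map g xs)"
      unfolding distinct_conv_nth using dec by (metis less_irrefl linorder_neqE_nat)
  qed
qed

lemma JK_res_basis:
  fixes A :: "(real ^ 'v::finite) set"
  assumes A: "is_basis v0 A" and fs: "frame_in v0 A fs"
    and \<gamma>: "\<And>Fs. Fs \<in> flags v0 A \<Longrightarrow> adapted_basis v0 fs Fs (\<gamma> Fs)"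
    and \<zeta>: "\<zeta> \<in> dual_a v0" "inj_on (representation A \<zeta>) A"
    and r: "r > 0" and f: "holomorphic_punctured (frame_covectors v0 A) A r f"
    and bs: "distinct bs" "set bs = A"
  shows "JK_res v0 fs \<gamma> A \<zeta> f = (if \<forall>a\<in>A. 0 < representation A \<zeta> a then IR0 v0 bs f else 0)"
proof -
  obtain as where as: "distinct as" "set as = A"
    and dec: "\<And>i j. i < j \<Longrightarrow> j < length as \<Longrightarrow> representation A \<zeta> (as ! j) < representation A \<zeta> (as ! i)"
    using decreasing_enumeration[OF is_basis_facts(2)[OF A] \<zeta>(2)] by metis
  have basl: "is_basis_list v0 as" and bbsl: "is_basis_list v0 bs"
    using as A bs by (auto simp: is_basis_list_def)
  show ?thesis
  proof (cases "\<forall>a\<in>A. 0 < representation A \<zeta> a")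
    case True
    have "{Fs. Fs \<in> flags v0 A \<and> \<zeta> \<in> kappa_cone A Fs} = {ordered_flag as}"
    proof safe
      fix Fs assume "Fs \<in> flags v0 A" "\<zeta> \<in> kappa_cone A Fs"
      then show "Fs = ordered_flag as"
        using flag_of_cone_unique[OF basl, of \<zeta> Fs] dec as(2) by simp
    next
      show "ordered_flag as \<in> flags v0 A" using ordered_flag_in_flags[OF basl] as(2) by simp
      show "\<zeta> \<in> kappa_cone A (ordered_flag as)"
        using ordered_flag_cone[OF basl \<zeta>(1)] dec True as(2) by simp
    qed
    then have "JK_res v0 fs \<gamma> A \<zeta> f =
        of_int (nu v0 fs (set as) (ordered_flag as)) * IR0 v0 (\<gamma> (ordered_flag as)) f"
      using as(2) by (simp add: JK_res_def)
    also have "\<dots> = IR0 v0 as f"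
    proof (rule nu_times_IR0[OF basl])
      show "adapted_basis v0 fs (ordered_flag as) (\<gamma> (ordered_flag as))"
        using \<gamma> ordered_flag_in_flags[OF basl] as(2) by simp
    qed (use fs as(2) r f kappa_list_ordered_flag[OF basl] in \<open>auto simp: ordered_flag_nth\<close>)
    also have "\<dots> = IR0 v0 bs f"
      by (rule IR0_perm[OF basl bbsl _ r]) (use as bs f in auto)
    finally show ?thesis using True by simp
  next
    case False
    then have "{Fs. Fs \<in> flags v0 A \<and> \<zeta> \<in> kappa_cone A Fs} = {}"
      using kappa_cone_coefficients(1)[OF A] by blast
    then show ?thesis unfolding JK_res_def using False by (simp only: sum.empty if_False)
  qed
qed

section \<open>Singular points, regularity and chambers\<close>

lemma weights_subset_dual_a: "weights Q v0 \<subseteq> dual_a v0"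
  by (auto simp: weights_def dual_a_def coord_def axis_def)

lemma weights_at_subset: "weights_at Q v0 R x \<subseteq> weights Q v0"
  by (auto simp: weights_at_def)

text \<open>
  If a weight at \<open>x\<close> did not belong to a chosen basis of weights at \<open>x\<close>, one hyperplane too many
  would pass through \<open>x\<close>.
\<close>

lemma is_basis_weights_at:
  fixes Q :: "('v::finite, 'e) pre_digraph"
  assumes generic: "generic_charge_cone Q v0 P" and R: "R \<in> P" and x: "x \<in> sing_points Q v0 R"
  shows "is_basis v0 (weights_at Q v0 R x)"
proof -
  obtain S where S: "S \<subseteq> weights Q v0" "independent S" "CARD('v) - 1 \<le> card S"
      "\<And>\<rho>. \<rho> \<in> S \<Longrightarrow> x \<in> hyperplane v0 R \<rho>"
    using x by (auto simp: sing_points_def)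
  have SV: "S \<subseteq> dual_a v0" using S(1) weights_subset_dual_a by blast
  have fin: "finite S" using S(2) by (rule independent_imp_finite)
  have "dual_a v0 \<subseteq> span S"
    using card_ge_dim_independent[OF SV S(2)] S(3) by (simp add: dim_dual_a)
  then have span: "span S = dual_a v0"
    using span_minimal[OF SV subspace_dual_a] by blast
  then have B: "is_basis v0 S" using S(2) by (simp add: is_basis_def)
  have "weights_at Q v0 R x = S"
  proof
    show "S \<subseteq> weights_at Q v0 R x" using S by (auto simp: weights_at_def)
    show "weights_at Q v0 R x \<subseteq> S"
    proof
      fix \<rho> assume \<rho>: "\<rho> \<in> weights_at Q v0 R x"
      show "\<rho> \<in> S"
      proof (rule ccontr)
        assume "\<rho> \<notin> S"
        then have "card (insert \<rho> S) = CARD('v)"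
          using is_basis_facts(3)[OF B] fin by simp
        moreover have "insert \<rho> S \<subseteq> weights Q v0" using S(1) \<rho> by (auto simp: weights_at_def)
        moreover have "\<forall>\<sigma>\<in>insert \<rho> S. x \<in> hyperplane v0 R \<sigma>" using S(4) \<rho> by (auto simp: weights_at_def)
        ultimately show False using generic R x unfolding generic_charge_cone_def by blast
      qed
    qed
  qed
  then show ?thesis using B by simp
qed

lemma norm_vector_scale: "norm (c *s (v :: complex ^ 'v::finite)) = cmod c * norm v"
  by (simp add: norm_vec_def vector_scalar_mult_def norm_mult L2_set_right_distrib)

lemma bounded_linear_vector_scale: "bounded_linear (\<lambda>t. t *s (v :: complex ^ 'v::finite))"
  by (rule bounded_linear_intro[of _ "norm v"])
     (simp_all add: Finite_Cartesian_Product.vec_eq_iff algebra_simps norm_vector_scale)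

lemma coord_subspace_complex_a: "coord_subspace (frame_covectors v0 A) A \<subseteq> complex_a v0"
  if "is_basis v0 A"
  using axis_notin_basis[OF that] by (force simp: coord_subspace_def frame_covectors_def complex_a_def)

lemma punctured_in_ball:
  fixes A :: "(real ^ 'v::finite) set"
  assumes A: "is_basis v0 A" and r: "r > 0"
  obtains r' where "r' > 0" "punctured (frame_covectors v0 A) A r' \<subseteq> ball 0 r"
proof -
  let ?B = "frame_covectors v0 A" and ?e = "frame_vector v0 A"
  interpret dual_frame ?B ?e by (rule dual_frame_basis[OF A])
  define N where "N = (\<Sum>a\<in>A. norm (?e a))"
  have N: "N \<ge> 0" by (auto simp: N_def intro: sum_nonneg)
  \<comment> \<open>By the triangle inequality; the summand 1 avoids a division by zero when \<open>A\<close> is empty.\<close>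
  show ?thesis
  proof (rule that[of "r / (1 + N)"])
    show "r / (1 + N) > 0" using r N by simp
    show "punctured ?B A (r / (1 + N)) \<subseteq> ball 0 r"
    proof
      fix u assume u: "u \<in> punctured ?B A (r / (1 + N))"
      have "u = (\<Sum>a\<in>A. pair_complex a u *s ?e a)"
        by (rule coord_subspace_expand) (use u in \<open>auto simp: punctured_def frame_covectors_def\<close>)
      then have "norm u \<le> (\<Sum>a\<in>A. norm (pair_complex a u *s ?e a))"
        by (metis norm_sum)
      also have "\<dots> \<le> (\<Sum>a\<in>A. r / (1 + N) * norm (?e a))"
        unfolding norm_vector_scale
        by (intro sum_mono mult_right_mono) (use u in \<open>auto simp: punctured_def intro: less_imp_le\<close>)
      also have "\<dots> = r / (1 + N) * N" by (simp add: N_def sum_distrib_left)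
      also have "\<dots> < r" using N r by (simp add: field_simps)
      finally show "u \<in> ball 0 r" by simp
    qed
  qed
qed

lemma holomorphic_punctured_translate:
  fixes f :: "complex ^ 'v::finite \<Rightarrow> complex"
  assumes A: "is_basis v0 A" and x: "x \<in> complex_a v0" and r: "r > 0"
    and f: "holomorphic_a v0 f ((ball x r \<inter> complex_a v0) - (\<Union>g\<in>A. {u. pair_complex g (u - x) = 0}))"
  shows "\<exists>r'>0. holomorphic_punctured (frame_covectors v0 A) A r' (\<lambda>u. f (u + x))"
proof -
  let ?B = "frame_covectors v0 A"
  let ?D = "(ball x r \<inter> complex_a v0) - (\<Union>g\<in>A. {u. pair_complex g (u - x) = 0})"
  obtain r' where r': "r' > 0" "punctured ?B A r' \<subseteq> ball 0 r"
    by (rule punctured_in_ball[OF A r])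
  have sub: "u \<in> complex_a v0" if "u \<in> coord_subspace ?B A" for u
    using coord_subspace_complex_a[OF A] that by blast
  have D: "u + x \<in> ?D" if u: "u \<in> punctured ?B A r'" for u
    using u r'(2) sub[of u] x by (auto simp: punctured_def dist_norm complex_a_linear)
  have "continuous_on ?D f"
    unfolding continuous_on_eq_continuous_within
  proof
    fix u assume "u \<in> ?D"
    then obtain L where "(f has_derivative L) (at u within complex_a v0)"
      using f unfolding holomorphic_a_def by blast
    then show "continuous (at u within ?D) f"
      by (rule has_derivative_continuous[OF has_derivative_subset]) auto
  qed
  then have "continuous_on (punctured ?B A r') (\<lambda>u. f (u + x))"
    by (rule continuous_on_compose2) (use D in \<open>auto intro!: continuous_intros\<close>)
  moreover have "(\<lambda>t. f (u + t *s v + x)) holomorphic_on {t. u + t *s v \<in> punctured ?B A r'}"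
    if u: "u \<in> coord_subspace ?B A" and v: "v \<in> coord_subspace ?B A" for u v
    unfolding holomorphic_on_def
  proof
    let ?T = "{t. u + t *s v \<in> punctured ?B A r'}" and ?g = "\<lambda>t. u + t *s v + x"
    fix t assume "t \<in> ?T"
    then have "?g t \<in> ?D" using D[of "u + t *s v"] by simp
    then obtain L where L: "(f has_derivative L) (at (?g t) within complex_a v0)"
      and hom: "\<And>c w. L (c *s w) = c * L w"
      using f unfolding holomorphic_a_def by blast
    have g: "(?g has_derivative (\<lambda>t. t *s v)) (at t within ?T)"
    proof -
      have "((\<lambda>t. t *s v) has_derivative (\<lambda>t. t *s v)) (at t within ?T)"
        by (rule bounded_linear_imp_has_derivative[OF bounded_linear_vector_scale])
      from has_derivative_add[OF has_derivative_add[OF has_derivative_const this] has_derivative_const]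
      show ?thesis by simp
    qed
    have "?g ` ?T \<subseteq> complex_a v0"
      using sub[OF u] sub[OF v] x by (auto intro!: complex_a_linear)
    then have "((\<lambda>t. f (?g t)) has_derivative (\<lambda>s. L (s *s v))) (at t within ?T)"
      by (intro has_derivative_in_compose[OF g] has_derivative_subset[OF L])
    then have "((\<lambda>t. f (?g t)) has_field_derivative L v) (at t within ?T)"
      by (simp add: has_field_derivative_def hom mult_commute_abs)
    then show "(\<lambda>t. f (?g t)) field_differentiable at t within ?T"
      by (auto simp: field_differentiable_def)
  qed
  ultimately show ?thesis using r'(1) unfolding holomorphic_punctured_def by blast
qed

lemma zero_coefficient_in_span:
  assumes A: "is_basis v0 A" and \<xi>: "\<xi> \<in> dual_a v0" and z: "representation A \<xi> a = 0" and a: "a \<in> A"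
  shows "\<xi> \<in> span (A - {a})"
proof -
  note A' = is_basis_facts[OF A]
  have "\<xi> = (\<Sum>b\<in>A. representation A \<xi> b *\<^sub>R b)"
    using \<xi> A' by (simp add: sum_representation_eq)
  also have "\<dots> = (\<Sum>b\<in>A - {a}. representation A \<xi> b *\<^sub>R b)"
    using a z A'(2) by (simp add: sum.remove)
  also have "\<dots> \<in> span (A - {a})" by (intro span_sum span_scale span_base)
  finally show ?thesis .
qed

lemma regular_notin_span:
  fixes S :: "(real ^ 'v::finite) set"
  assumes "\<xi> \<in> regular_vectors v0 S" "T \<subseteq> S" "finite T" "card T + 1 = CARD('v) - 1"
  shows "\<xi> \<notin> span T"
proof -
  have "\<forall>T\<subseteq>S. finite T \<and> card T + 1 = CARD('v) - 1 \<longrightarrow> \<xi> \<notin> span T"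
    using assms(1) unfolding regular_vectors_def mem_Collect_eq by (rule conjunct2)
  then show ?thesis using assms(2-4) by simp
qed

lemma regular_coefficient_nonzero:
  assumes A: "is_basis v0 A" "A \<subseteq> S" and \<xi>: "\<xi> \<in> regular_vectors v0 S" and a: "a \<in> A"
  shows "representation A \<xi> a \<noteq> 0"
proof
  note A' = is_basis_facts[OF A(1)]
  assume "representation A \<xi> a = 0"
  then have "\<xi> \<in> span (A - {a})"
    using zero_coefficient_in_span[OF A(1) _ _ a] \<xi> by (simp add: regular_vectors_def)
  moreover have "card (A - {a}) + 1 = card A"
    using card_Suc_Diff1[OF A'(2) a] by simp
  moreover have "A - {a} \<subseteq> S" "finite (A - {a})" using A(2) A'(2) by auto
  ultimately show False
    using regular_notin_span[OF \<xi>, of "A - {a}"] A'(3) by simp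
qed

text \<open>
  If \<open>\<zeta>\<close> had equal coefficients along \<open>a\<close> and \<open>b\<close>, it would lie in the span of \<open>a + b\<close> and the
  other elements of \<open>A\<close>; these are \<open>n - 1\<close> partial sums.
\<close>

lemma regular_coefficients_distinct:
  assumes A: "is_basis v0 A" "A \<subseteq> S" and \<zeta>: "\<zeta> \<in> regular_vectors v0 (partial_sums S)"
  shows "inj_on (representation A \<zeta>) A"
proof (rule inj_onI, rule ccontr)
  note A' = is_basis_facts[OF A(1)]
  let ?c = "representation A \<zeta>"
  fix a b assume ab: "a \<in> A" "b \<in> A" "?c a = ?c b" "a \<noteq> b"
  let ?D = "A - {a, b}" and ?T = "insert (a + b) (A - {a, b})"
  have \<zeta>V: "\<zeta> \<in> dual_a v0" using \<zeta> by (simp add: regular_vectors_def)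
  have nin: "a + b \<notin> ?D"
  proof
    assume "a + b \<in> ?D"
    then have "a + b \<in> span (A - {a})" "b \<in> span (A - {a})"
      using ab by (auto intro: span_base)
    then have "a + b - b \<in> span (A - {a})" by (rule span_diff)
    then show False using A'(1) ab(1) by (auto simp: dependent_def)
  qed
  have "card ?D + 2 = card A"
    using ab A'(2) card_Diff_subset[of "{a, b}" A] card_mono[of A "{a, b}"] by auto
  then have card: "card ?T + 1 = card A" using nin A'(2) by simp
  have "\<zeta> = (\<Sum>d\<in>A. ?c d *\<^sub>R d)"
    using \<zeta>V A' by (simp add: sum_representation_eq)
  also have "\<dots> = (\<Sum>d\<in>?D. ?c d *\<^sub>R d) + (\<Sum>d\<in>{a, b}. ?c d *\<^sub>R d)"
    by (rule sum.subset_diff) (use ab A'(2) in auto)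
  also have "(\<Sum>d\<in>{a, b}. ?c d *\<^sub>R d) = ?c a *\<^sub>R (a + b)"
    using ab by (simp add: scaleR_add_right)
  also have "(\<Sum>d\<in>?D. ?c d *\<^sub>R d) + ?c a *\<^sub>R (a + b) \<in> span ?T"
    by (intro span_add span_sum span_scale span_base) auto
  finally have "\<zeta> \<in> span ?T" .
  moreover have "?T \<subseteq> partial_sums S"
  proof
    fix d assume "d \<in> ?T"
    then consider "d = \<Sum>{a, b}" | "d = \<Sum>{d}" "d \<in> A" using ab by auto
    then show "d \<in> partial_sums S"
      unfolding partial_sums_def by cases (use ab A(2) in blast)+
  qed
  moreover have "finite ?T" using A'(2) by simp
  ultimately show False
    using regular_notin_span[OF \<zeta>, of ?T] card A'(3) by metis
qed

text \<open>
  A coefficient is a continuous function on the chamber. It has no zero there, since a vector whose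
  \<open>a\<close>-coefficient vanishes lies in the span of the \<open>n - 1\<close> other elements of \<open>A\<close>. As the chamber is
  connected, the sign is constant.
\<close>

lemma chamber_coefficient_sign:
  assumes A: "is_basis v0 A" "A \<subseteq> S" and C: "C \<in> chambers v0 S" "\<xi> \<in> C" "\<eta> \<in> C"
    and a: "a \<in> A" and pos: "0 < representation A \<xi> a"
  shows "0 < representation A \<eta> a"
proof (rule ccontr)
  let ?g = "\<lambda>\<xi>. pair_real \<xi> (dual_vector v0 A a)"
  have CS: "C \<subseteq> regular_vectors v0 S" and conn: "connected C"
    using in_components_subset in_components_connected C(1) unfolding chambers_def by auto
  have g: "?g \<xi> = representation A \<xi> a" and nz: "?g \<xi> \<noteq> 0" if "\<xi> \<in> C" for \<xi>
  proof -
    have reg: "\<xi> \<in> regular_vectors v0 S" using that CS by blast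
    then have "\<xi> \<in> dual_a v0" by (simp add: regular_vectors_def)
    then show "?g \<xi> = representation A \<xi> a" by (rule pair_real_dual_vector[OF A(1)])
    then show "?g \<xi> \<noteq> 0" using regular_coefficient_nonzero[OF A reg a] by simp
  qed
  have "connected (?g ` C)"
    by (intro connected_continuous_image conn) (auto simp: pair_real_alt intro!: continuous_intros)
  moreover assume "\<not> 0 < representation A \<eta> a"
  then have "?g \<eta> \<le> 0" "0 \<le> ?g \<xi>" using g C(2,3) pos by simp_all
  ultimately have "0 \<in> ?g ` C"
    by (rule connectedD_interval[OF _ imageI[OF C(3)] imageI[OF C(2)]])
  then obtain \<xi>' where "\<xi>' \<in> C" "?g \<xi>' = 0" by (rule imageE) simp
  then show False using nz by simp
qed

theorem proposition6p5:
  fixes Q :: "('v::finite, 'e) pre_digraph"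
    and v0 :: 'v
    and \<theta> \<zeta> :: "real ^ 'v"
    and P :: "(real ^ 'v \<Rightarrow> real) set"
    and R :: "real ^ 'v \<Rightarrow> real"
    and f :: "complex ^ 'v \<Rightarrow> complex"
    and fs :: "complex ^ 'v \<Rightarrow> (real ^ 'v) list"
    and \<gamma> :: "complex ^ 'v \<Rightarrow> (real ^ 'v) set list \<Rightarrow> (real ^ 'v) list"
    and \<phi>_order :: "complex ^ 'v \<Rightarrow> (real ^ 'v) list"
  assumes "fin_digraph Q" and "verts Q = UNIV"
    and "loopfree_digraph Q" and "\<not> (\<exists>p. pre_digraph.cycle Q p)"
    and "(\<Sum>v\<in>UNIV. \<theta> $ v) = 0"
    and "theta_tilde v0 \<theta> \<in> regular_vectors v0 (weights Q v0)"
    and "\<zeta> \<in> regular_vectors v0 (partial_sums (weights Q v0))"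
    and "\<exists>C\<in>chambers v0 (weights Q v0). \<zeta> \<in> C \<and> - theta_tilde v0 \<theta> \<in> C"
    and "generic_charge_cone Q v0 P" and "R \<in> P"
    and "meromorphic_a v0 f"
    and "\<And>x. x \<in> sing_points Q v0 R \<Longrightarrow>
           \<exists>r>0. holomorphic_a v0 f
             ((ball x r \<inter> complex_a v0) -
              (\<Union>g\<in>weights_at Q v0 R x. {u. pair_complex g (u - x) = 0}))"
    and "\<And>x. x \<in> sing_points Q v0 R \<Longrightarrow> frame_in v0 (weights_at Q v0 R x) (fs x)"
    and "\<And>x Fs. x \<in> sing_points Q v0 R \<Longrightarrow> Fs \<in> flags v0 (weights_at Q v0 R x) \<Longrightarrow>
           adapted_basis v0 (fs x) Fs (\<gamma> x Fs)"
    and "\<And>x. x \<in> sing_points Q v0 R \<Longrightarrow>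
           distinct (\<phi>_order x) \<and> set (\<phi>_order x) = weights_at Q v0 R x"
  shows "JK Q v0 R fs \<gamma> f \<zeta> =
    (\<Sum>x\<in>sing_points Q v0 R. eps_tilde Q v0 R \<theta> x * IR0 v0 (\<phi>_order x) (\<lambda>u. f (u + x)))"
  unfolding JK_def
proof (rule sum.cong[OF refl])
  fix x assume x: "x \<in> sing_points Q v0 R"
  let ?A = "weights_at Q v0 R x" and ?\<theta> = "theta_tilde v0 \<theta>"
  note A = is_basis_weights_at[OF assms(9,10) x] weights_at_subset[of Q v0 R x]
  note A' = is_basis_facts[OF A(1)]
  have \<theta>V: "?\<theta> \<in> dual_a v0" and \<zeta>V: "\<zeta> \<in> dual_a v0"
    using assms(6,7) by (auto simp: regular_vectors_def)
  obtain C where C: "C \<in> chambers v0 (weights Q v0)" "\<zeta> \<in> C" "- ?\<theta> \<in> C"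
    using assms(8) by blast
  obtain r where "r > 0" "holomorphic_a v0 f ((ball x r \<inter> complex_a v0) -
      (\<Union>g\<in>?A. {u. pair_complex g (u - x) = 0}))"
    using assms(12)[OF x] by blast
  moreover have "x \<in> complex_a v0" using x by (simp add: sing_points_def)
  ultimately obtain r' where r': "r' > 0"
      "holomorphic_punctured (frame_covectors v0 ?A) ?A r' (\<lambda>u. f (u + x))"
    using holomorphic_punctured_translate[OF A(1)] by blast
  have "JK_res v0 (fs x) (\<gamma> x) ?A \<zeta> (\<lambda>u. f (u + x)) =
      (if \<forall>a\<in>?A. 0 < representation ?A \<zeta> a then IR0 v0 (\<phi>_order x) (\<lambda>u. f (u + x)) else 0)"
    by (rule JK_res_basis[OF A(1) assms(13)[OF x] assms(14)[OF x] \<zeta>V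
          regular_coefficients_distinct[OF A assms(7)] r'])
       (use assms(15)[OF x] in auto)
  moreover have "(\<forall>a\<in>?A. 0 < representation ?A \<zeta> a) \<longleftrightarrow> (\<forall>a\<in>?A. representation ?A ?\<theta> a < 0)"
  proof -
    have neg: "representation ?A (- ?\<theta>) a = - representation ?A ?\<theta> a" for a
      using representation_neg[OF A'(1)] \<theta>V A'(5) by simp
    have "0 < representation ?A \<zeta> a \<longleftrightarrow> 0 < representation ?A (- ?\<theta>) a" if "a \<in> ?A" for a
      using chamber_coefficient_sign[OF A C(1) _ _ that] C by blast
    then show ?thesis by (simp add: neg)
  qed
  ultimately show "JK_res v0 (fs x) (\<gamma> x) ?A \<zeta> (\<lambda>u. f (u + x)) =
      eps_tilde Q v0 R \<theta> x * IR0 v0 (\<phi>_order x) (\<lambda>u. f (u + x))"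
    by (simp add: eps_tilde_def)
qed

end
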